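(* The following problem ($k$-o2o-rtt) can be solved in time $2^{O(k)}\, m\log|\mathbb{T}|$, where $m=\sum_{T\in\mathbb{T}}|T|$ is the sum of the trip lengths (numbers of edges): given a trip network $(D,\mathbb{T})$, a source node $s$, a target node $t$, and $k\in\mathbb{N}$, decide whether there exists a temporalisation $\tau$ such that $t$ is $(k,\tau)$-reachable from $s$.
   Context: A weighted multidigraph $D=(V,E)$ has a finite node set $V$ and a finite multiset $E$ of edges $(u,v,w)$ with weight $w>0$. A trip network is a pair $(D,\mathbb{T})$ where $\mathbb{T}$ is a finite multiset of walks in $D$ (trips); every node and edge of $D$ appears in some trip. A temporalisation $\tau$ assigns a real starting time $\tau(T)$ to each trip. For a trip $T=e_1,\dots,e_k$ with $e_i=(u_i,v_i,w_i)$, it induces temporal edges $(u_i,v_i,\tau(T)+\sum_{j<i}w_j,w_i)$ (tail, head, starting time, travel time); these are the edges induced by $T$. The induced temporal graph $G[D,\mathbb{T},\tau]$ has node set $V$ and all temporal edges induced by all trips. A temporal path from $u$ to $v$ is a sequence of consecutive temporal edges from $u$ to $v$ in which each edge's starting time is at least the arrival time (starting time plus travel time) of the previous one. A node $v$ is $(k,\tau)$-reachable from $u$ if there is a temporal path in $G[D,\mathbb{T},\tau]$ from $u$ to $v$ all of whose edges are induced by at most $k$ different trips of $\mathbb{T}$. *)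

theory Defs
  imports Complex_Main "Graph_Theory.Digraph" "Graph_Theory.Arc_Walk"
begin

section \<open>Trip networks and temporalisations\<close>

text \<open>
  The multiset of weighted edges is the family of arcs \<open>e\<close>, each carrying the triple
  \<open>(tail D e, head D e, wt e)\<close>; parallel arcs, equal weights and loops are allowed.
  The multiset of trips is the family \<open>Ts ! i\<close>, \<open>i < length Ts\<close>, so equal walks at
  different positions are different trips. A trip is a non-empty sequence of edges.
\<close>

locale trip_network = fin_digraph D
  for D :: "('v, 'e) pre_digraph" +
  fixes wt :: "'e \<Rightarrow> real"
    and Ts :: "'e list list"
  assumes weight_pos: "e \<in> arcs D \<Longrightarrow> 0 < wt e"
    and trip_nonempty: "T \<in> set Ts \<Longrightarrow> T \<noteq> []"
    and trip_walk: "T \<in> set Ts \<Longrightarrow> \<exists>u v. pre_digraph.awalk D u T v"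
    and node_in_trip: "v \<in> verts D \<Longrightarrow> \<exists>T\<in>set Ts. \<exists>e\<in>set T. v = tail D e \<or> v = head D e"
    and arc_in_trip: "e \<in> arcs D \<Longrightarrow> \<exists>T\<in>set Ts. e \<in> set T"

definition total_trip_length :: "'e list list \<Rightarrow> nat" where
  "total_trip_length Ts = (\<Sum>T\<leftarrow>Ts. length T)"

text \<open>A temporal edge is a tuple (tail, head, starting time, travel time).\<close>

type_synonym 'v temporal_edge = "'v \<times> 'v \<times> real \<times> real"

fun te_tail :: "'v temporal_edge \<Rightarrow> 'v" where "te_tail (u, v, t, d) = u"
fun te_head :: "'v temporal_edge \<Rightarrow> 'v" where "te_head (u, v, t, d) = v"
fun te_start :: "'v temporal_edge \<Rightarrow> real" where "te_start (u, v, t, d) = t"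
fun te_arrival :: "'v temporal_edge \<Rightarrow> real" where "te_arrival (u, v, t, d) = t + d"

text \<open>A temporal graph is a pair of a node set and a set of temporal edges.\<close>

type_synonym 'v temporal_graph = "'v set \<times> 'v temporal_edge set"

definition trip_edges ::
  "('v, 'e) pre_digraph \<Rightarrow> ('e \<Rightarrow> real) \<Rightarrow> 'e list \<Rightarrow> real \<Rightarrow> 'v temporal_edge set" where
  "trip_edges D wt T t0 =
     {(tail D (T ! i), head D (T ! i), t0 + (\<Sum>j<i. wt (T ! j)), wt (T ! i)) | i. i < length T}"

text \<open>A temporalisation gives the \<open>i\<close>-th trip the starting time \<open>\<tau> i\<close>.\<close>

definition induced_temporal_graph ::
  "('v, 'e) pre_digraph \<Rightarrow> ('e \<Rightarrow> real) \<Rightarrow> 'e list list \<Rightarrow> (nat \<Rightarrow> real) \<Rightarrow> 'v temporal_graph" where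
  "induced_temporal_graph D wt Ts \<tau> =
     (verts D, \<Union>i<length Ts. trip_edges D wt (Ts ! i) (\<tau> i))"

definition temporal_path ::
  "'v temporal_graph \<Rightarrow> 'v \<Rightarrow> 'v temporal_edge list \<Rightarrow> 'v \<Rightarrow> bool" where
  "temporal_path G u P v \<longleftrightarrow>
     u \<in> fst G \<and> v \<in> fst G \<and> set P \<subseteq> snd G \<and>
     successively (\<lambda>e f. te_head e = te_tail f \<and> te_arrival e \<le> te_start f) P \<and>
     (if P = [] then u = v else te_tail (hd P) = u \<and> te_head (last P) = v)"

definition reachable ::
  "('v, 'e) pre_digraph \<Rightarrow> ('e \<Rightarrow> real) \<Rightarrow> 'e list list \<Rightarrow> nat \<Rightarrow> (nat \<Rightarrow> real) \<Rightarrow> 'v \<Rightarrow> 'v \<Rightarrow> bool" where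
  "reachable D wt Ts k \<tau> u v \<longleftrightarrow>
     (\<exists>P K. temporal_path (induced_temporal_graph D wt Ts \<tau>) u P v \<and>
            K \<subseteq> {..<length Ts} \<and> card K \<le> k \<and>
            set P \<subseteq> (\<Union>i\<in>K. trip_edges D wt (Ts ! i) (\<tau> i)))"

definition o2o_rtt ::
  "('v, 'e) pre_digraph \<Rightarrow> ('e \<Rightarrow> real) \<Rightarrow> 'e list list \<Rightarrow> 'v \<Rightarrow> 'v \<Rightarrow> nat \<Rightarrow> bool" where
  "o2o_rtt D wt Ts s t k \<longleftrightarrow> (\<exists>\<tau>. reachable D wt Ts k \<tau> s t)"

section \<open>The machine model\<close>

text \<open>
  A word RAM with word length \<open>w\<close>, extended by a separate real memory because the edge
  weights are arbitrary positive reals. Word operations are exact modulo \<open>2 ^ w\<close>; reals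
  admit field operations and comparison, and there is no conversion from reals to words
  (no rounding). Register numbers are fixed by the program text, while memory is addressed
  indirectly through word registers, so a program uses finitely many registers and at most
  \<open>2 ^ w\<close> cells of each memory. Control flow is structured; every instruction and every
  evaluation of a test takes one time unit, which agrees with counting the steps of the
  corresponding jump program up to a constant factor.
\<close>

record state =
  wreg :: "nat \<Rightarrow> nat"
  wmem :: "nat \<Rightarrow> nat"
  rreg :: "nat \<Rightarrow> real"
  rmem :: "nat \<Rightarrow> real"

datatype word_op = Add | Sub | Mul | Div | Mod | And | Or | Xor | Shl | Shr

datatype real_op = RAdd | RSub | RMul | RDiv

datatype instr =
    Const nat nat
  | Op word_op nat nat nat
  | Load nat nat
  | Store nat nat
  | RCast nat nat
  | ROp real_op nat nat nat
  | RLoad nat nat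
  | RStore nat nat

datatype test = Eq nat nat | Less nat nat | RLess nat nat

datatype program =
    Instr instr
  | Seq program program
  | Cond test program program
  | While test program

fun eval_word :: "nat \<Rightarrow> word_op \<Rightarrow> nat \<Rightarrow> nat \<Rightarrow> nat" where
  "eval_word w Add x y = (x + y) mod 2 ^ w"
| "eval_word w Sub x y = (x + 2 ^ w - y) mod 2 ^ w"
| "eval_word w Mul x y = (x * y) mod 2 ^ w"
| "eval_word w Div x y = (x div y) mod 2 ^ w"
| "eval_word w Mod x y = (x mod y) mod 2 ^ w"
| "eval_word w And x y = (Bit_Operations.and x y) mod 2 ^ w"
| "eval_word w Or x y = (Bit_Operations.or x y) mod 2 ^ w"
| "eval_word w Xor x y = (Bit_Operations.xor x y) mod 2 ^ w"
| "eval_word w Shl x y = (push_bit y x) mod 2 ^ w"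
| "eval_word w Shr x y = (drop_bit y x) mod 2 ^ w"

fun eval_real :: "real_op \<Rightarrow> real \<Rightarrow> real \<Rightarrow> real" where
  "eval_real RAdd x y = x + y"
| "eval_real RSub x y = x - y"
| "eval_real RMul x y = x * y"
| "eval_real RDiv x y = x / y"

text \<open>The first argument of an instruction is the target register, except that
  \<open>Store a b\<close> and \<open>RStore a b\<close> write register \<open>b\<close> to the address held in register \<open>a\<close>.\<close>

fun instr_step :: "nat \<Rightarrow> instr \<Rightarrow> state \<Rightarrow> state" where
  "instr_step w (Const d c) \<sigma> = \<sigma>\<lparr>wreg := (wreg \<sigma>)(d := c mod 2 ^ w)\<rparr>"
| "instr_step w (Op f d a b) \<sigma> = \<sigma>\<lparr>wreg := (wreg \<sigma>)(d := eval_word w f (wreg \<sigma> a) (wreg \<sigma> b))\<rparr>"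
| "instr_step w (Load d a) \<sigma> = \<sigma>\<lparr>wreg := (wreg \<sigma>)(d := wmem \<sigma> (wreg \<sigma> a))\<rparr>"
| "instr_step w (Store a b) \<sigma> = \<sigma>\<lparr>wmem := (wmem \<sigma>)(wreg \<sigma> a := wreg \<sigma> b)\<rparr>"
| "instr_step w (RCast d a) \<sigma> = \<sigma>\<lparr>rreg := (rreg \<sigma>)(d := real (wreg \<sigma> a))\<rparr>"
| "instr_step w (ROp f d a b) \<sigma> = \<sigma>\<lparr>rreg := (rreg \<sigma>)(d := eval_real f (rreg \<sigma> a) (rreg \<sigma> b))\<rparr>"
| "instr_step w (RLoad d a) \<sigma> = \<sigma>\<lparr>rreg := (rreg \<sigma>)(d := rmem \<sigma> (wreg \<sigma> a))\<rparr>"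
| "instr_step w (RStore a b) \<sigma> = \<sigma>\<lparr>rmem := (rmem \<sigma>)(wreg \<sigma> a := rreg \<sigma> b)\<rparr>"

fun holds :: "test \<Rightarrow> state \<Rightarrow> bool" where
  "holds (Eq a b) \<sigma> \<longleftrightarrow> wreg \<sigma> a = wreg \<sigma> b"
| "holds (Less a b) \<sigma> \<longleftrightarrow> wreg \<sigma> a < wreg \<sigma> b"
| "holds (RLess a b) \<sigma> \<longleftrightarrow> rreg \<sigma> a < rreg \<sigma> b"

text \<open>\<open>exec w p \<sigma> n \<sigma>'\<close>: with word length \<open>w\<close>, program \<open>p\<close> started in \<open>\<sigma>\<close> halts in \<open>\<sigma>'\<close>
  after exactly \<open>n\<close> time units.\<close>

inductive exec :: "nat \<Rightarrow> program \<Rightarrow> state \<Rightarrow> nat \<Rightarrow> state \<Rightarrow> bool" for w :: nat where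
  Instr: "exec w (Instr i) \<sigma> 1 (instr_step w i \<sigma>)"
| Seq: "exec w p \<sigma> m \<sigma>' \<Longrightarrow> exec w q \<sigma>' n \<sigma>'' \<Longrightarrow> exec w (Seq p q) \<sigma> (m + n) \<sigma>''"
| CondTrue: "holds b \<sigma> \<Longrightarrow> exec w p \<sigma> n \<sigma>' \<Longrightarrow> exec w (Cond b p q) \<sigma> (1 + n) \<sigma>'"
| CondFalse: "\<not> holds b \<sigma> \<Longrightarrow> exec w q \<sigma> n \<sigma>' \<Longrightarrow> exec w (Cond b p q) \<sigma> (1 + n) \<sigma>'"
| WhileFalse: "\<not> holds b \<sigma> \<Longrightarrow> exec w (While b p) \<sigma> 1 \<sigma>"
| WhileTrue: "holds b \<sigma> \<Longrightarrow> exec w p \<sigma> m \<sigma>' \<Longrightarrow> exec w (While b p) \<sigma>' n \<sigma>'' \<Longrightarrow>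
    exec w (While b p) \<sigma> (1 + m + n) \<sigma>''"

inductive_cases exec_InstrE: "exec w (Instr i) \<sigma> n \<sigma>'"
inductive_cases exec_SeqE: "exec w (Seq p q) \<sigma> n \<sigma>'"
inductive_cases exec_CondE: "exec w (Cond b p q) \<sigma> n \<sigma>'"
inductive_cases exec_WhileE: "exec w (While b p) \<sigma> n \<sigma>'"

lemma exec_deterministic:
  "exec w p \<sigma> m \<sigma>' \<Longrightarrow> exec w p \<sigma> n \<sigma>'' \<Longrightarrow> m = n \<and> \<sigma>' = \<sigma>''"
proof (induction arbitrary: n \<sigma>'' rule: exec.induct)
  case (Instr i \<sigma>)
  then show ?case by (auto elim: exec_InstrE)
next
  case (Seq p \<sigma> m \<sigma>' q m' \<tau>)
  from Seq.prems obtain l l' \<rho> where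
    "n = l + l'" "exec w p \<sigma> l \<rho>" "exec w q \<rho> l' \<sigma>''"
    by (rule exec_SeqE)
  then show ?case
    using Seq.IH(1)[of l \<rho>] Seq.IH(2)[of l' \<sigma>''] by simp
next
  case (CondTrue b \<sigma> p m \<sigma>' q)
  from CondTrue.prems CondTrue.hyps obtain l where "n = 1 + l" "exec w p \<sigma> l \<sigma>''"
    by (auto elim!: exec_CondE)
  then show ?case using CondTrue.IH by simp
next
  case (CondFalse b \<sigma> q m \<sigma>' p)
  from CondFalse.prems CondFalse.hyps obtain l where "n = 1 + l" "exec w q \<sigma> l \<sigma>''"
    by (auto elim!: exec_CondE)
  then show ?case using CondFalse.IH by simp
next
  case (WhileFalse b \<sigma> p)
  from WhileFalse.prems show ?case
    by (rule exec_WhileE) (simp_all add: WhileFalse.hyps)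
next
  case (WhileTrue b \<sigma> p m \<sigma>' m' \<tau>)
  from WhileTrue.prems WhileTrue.hyps(1) obtain l \<rho> l' where
    "n = 1 + l + l'" "exec w p \<sigma> l \<rho>" "exec w (While b p) \<rho> l' \<sigma>''"
    by (cases rule: exec.cases) auto
  then show ?case
    using WhileTrue.IH(1)[of l \<rho>] WhileTrue.IH(2)[of l' \<sigma>''] by simp
qed

definition initial_state :: "nat \<Rightarrow> nat list \<Rightarrow> real list \<Rightarrow> state" where
  "initial_state w ws rs =
     \<lparr>wreg = (\<lambda>_. 0), wmem = (\<lambda>a. if a < length ws then ws ! a mod 2 ^ w else 0),
      rreg = (\<lambda>_. 0), rmem = (\<lambda>a. if a < length rs then rs ! a else 0)\<rparr>"

section \<open>Encoding of instances\<close>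

text \<open>As usual for graph algorithms, nodes and edges are numbered consecutively from 0.\<close>

definition numbered :: "(nat, nat) pre_digraph \<Rightarrow> bool" where
  "numbered D \<longleftrightarrow> verts D = {..<card (verts D)} \<and> arcs D = {..<card (arcs D)}"

definition input_words ::
  "(nat, nat) pre_digraph \<Rightarrow> nat list list \<Rightarrow> nat \<Rightarrow> nat \<Rightarrow> nat \<Rightarrow> nat list" where
  "input_words D Ts s t k =
     [card (verts D), card (arcs D), length Ts, s, t, k] @
     concat (map (\<lambda>e. [tail D e, head D e]) [0..<card (arcs D)]) @
     concat (map (\<lambda>T. length T # T) Ts)"

definition input_reals :: "(nat, nat) pre_digraph \<Rightarrow> (nat \<Rightarrow> real) \<Rightarrow> real list" where
  "input_reals D wt = map wt [0..<card (arcs D)]"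

text \<open>The answer is read off word register 0.\<close>

definition decides_within ::
  "nat \<Rightarrow> program \<Rightarrow> nat list \<Rightarrow> real list \<Rightarrow> bool \<Rightarrow> real \<Rightarrow> bool" where
  "decides_within w p ws rs answer time \<longleftrightarrow>
     (\<exists>n \<sigma>. exec w p (initial_state w ws rs) n \<sigma> \<and>
            wreg \<sigma> 0 = (if answer then 1 else 0) \<and> real n \<le> time)"

end

theory Submission
  imports Defs
begin

text \<open>
  Between its first and its last use of a trip a temporal path may stay on that trip, and distinct
  trips can be started as late as necessary. Hence \<open>t\<close> can be made reachable iff there is a ride from
  \<open>s\<close> to \<open>t\<close> that uses at most \<open>k\<close> pairwise distinct trips, each along one contiguous segment.

  Distinctness is enforced algebraically, as in extensor coding. To a ride on the trips
  \<open>i\<^sub>1, \<dots>, i\<^sub>l\<close> attach the square of the Vandermonde determinant of these numbers, which is positive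
  if they are distinct and zero otherwise, so that the sum over all rides on \<open>l\<close> trips is positive iff
  one of them has distinct trips. Expanding both factors of the square into minors indexed by sets
  \<open>A, B \<subseteq> {0..<k}\<close> of exponents turns this sum into a dynamic program with \<open>4 ^ k\<close> entries per node, each
  computed by one scan over the trips. Exact real arithmetic makes randomisation and hash families
  unnecessary.
\<close>

section \<open>Generalised Vandermonde determinants\<close>

text \<open>The determinant with rows \<open>x ^ a\<close>, \<open>a \<in> S\<close>, and one column for each entry \<open>x\<close> of the list, by
  expansion along the first column.\<close>
fun altpow :: "nat set \<Rightarrow> real list \<Rightarrow> real" where
  "altpow S [] = (if S = {} then 1 else 0)"
| "altpow S (x # xs) = (\<Sum>a\<in>S. (- 1) ^ card {b \<in> S. b < a} * x ^ a * altpow (S - {a}) xs)"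

text \<open>Deleting the smaller of two exponents lowers the rank of the larger by one, while
  deleting the larger leaves the rank of the smaller. Hence the two orders of deletion differ by
  exactly one sign.\<close>

lemma altpow_sign_swap:
  fixes S :: "nat set"
  assumes "finite S" "a \<in> S" "b \<in> S" "a \<noteq> b"
  shows "(- 1 :: real) ^ card {c \<in> S. c < a} * (- 1) ^ card {c \<in> S - {a}. c < b} =
    - ((- 1) ^ card {c \<in> S. c < b} * (- 1) ^ card {c \<in> S - {b}. c < a})"
proof -
  have remove: "card {c \<in> S. c < v} = Suc (card {c \<in> S - {u}. c < v})"
    and keep: "{c \<in> S - {v}. c < u} = {c \<in> S. c < u}"
    if "u \<in> S" "u < v" for u v
  proof -
    have "{c \<in> S. c < v} = insert u {c \<in> S - {u}. c < v}"
      using that by auto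
    then show "card {c \<in> S. c < v} = Suc (card {c \<in> S - {u}. c < v})"
      using \<open>finite S\<close> by simp
    show "{c \<in> S - {v}. c < u} = {c \<in> S. c < u}"
      using that by auto
  qed
  show ?thesis
  proof (cases "a < b")
    case True
    then show ?thesis
      using remove[of a b] keep[of a b] assms by simp
  next
    case False
    then show ?thesis
      using remove[of b a] keep[of b a] assms by simp
  qed
qed

text \<open>Expanding along the first two columns gives a double sum over exponents whose
  coefficients are antisymmetric in the two exponents.\<close>

lemma altpow_swap:
  assumes "finite S"
  shows "altpow S (x # y # zs) = - altpow S (y # x # zs)"
proof -
  \<comment> \<open>The value 0 on the diagonal lets both indices range over all of
    \<open>S\<close>, so that the two sums can be exchanged.\<close>
  define c where "c a b = (if a = b then 0 else
    (- 1) ^ card {c \<in> S. c < a} * (- 1) ^ card {c \<in> S - {a}. c < b} * altpow (S - {a, b}) zs)" for a b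
  have expand: "altpow S (u # v # zs) = (\<Sum>a\<in>S. \<Sum>b\<in>S. c a b * u ^ a * v ^ b)" for u v
  proof -
    have "(\<Sum>b\<in>S - {a}. (- 1) ^ card {c \<in> S. c < a} * u ^ a *
        ((- 1) ^ card {c \<in> S - {a}. c < b} * v ^ b * altpow (S - {a} - {b}) zs)) =
        (\<Sum>b\<in>S. c a b * u ^ a * v ^ b)" if "a \<in> S" for a
    proof (intro sum.mono_neutral_cong_left)
      show "\<forall>i\<in>S - (S - {a}). c a i * u ^ a * v ^ i = 0"
        by (auto simp: c_def)
    qed (use assms in \<open>auto simp: c_def Diff_insert2[symmetric] insert_commute mult_ac\<close>)
    then show ?thesis
      by (simp add: sum_distrib_left)
  qed
  have "c a b = - c b a" if "a \<in> S" "b \<in> S" for a b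
    using altpow_sign_swap[OF assms that] by (auto simp: c_def insert_commute)
  then have "(\<Sum>a\<in>S. \<Sum>b\<in>S. c a b * x ^ a * y ^ b) = (\<Sum>a\<in>S. \<Sum>b\<in>S. - (c b a * x ^ a * y ^ b))"
    by (intro sum.cong refl) (metis mult_minus_left)
  also have "\<dots> = - (\<Sum>b\<in>S. \<Sum>a\<in>S. c b a * y ^ b * x ^ a)"
    by (subst sum.swap) (simp add: sum_negf mult_ac)
  finally show ?thesis
    by (simp only: expand)
qed

text \<open>A repeated entry is moved next to its copy by adjacent swaps; swapping two equal
  neighbours then shows that the value equals its own negative.\<close>

lemma altpow_not_distinct:
  assumes "finite S" "\<not> distinct xs"
  shows "altpow S xs = 0"
  using assms
proof (induction xs arbitrary: S)
  case (Cons x xs)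
  show ?case
  proof (cases "distinct xs")
    case False
    then show ?thesis using Cons by simp
  next
    case True
    then obtain ys zs where xs: "xs = ys @ x # zs"
      using Cons.prems(2) split_list by fastforce
    \<comment> \<open>Swapping \<open>x\<close> past \<open>y\<close> and expanding along
      \<open>y\<close> leaves minors in which the copies of \<open>x\<close> are one step closer.
      These minors have fewer exponents, so \<open>S\<close> has to vary in the induction.\<close>
    have "finite S \<Longrightarrow> altpow S (x # ys @ x # zs) = 0" for S
    proof (induction ys arbitrary: S)
      case Nil
      then show ?case using altpow_swap[of S x x zs] by simp
    next
      case (Cons y ys)
      then show ?case
        using altpow_swap[of S x y "ys @ x # zs"] by (simp del: altpow.simps add: altpow.simps(2)[of _ y])
    qed
    then show ?thesis using Cons.prems(1) xs by simp
  qed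
qed simp

text \<open>Expanding along the first entry, \<open>altpow {..<length xs} xs\<close> is a polynomial in that entry
  whose leading coefficient is the minor for the remaining entries, which are also its roots.\<close>
lemma altpow_distinct:
  "distinct xs \<Longrightarrow> altpow {..<length xs} xs \<noteq> 0"
proof (induction xs)
  case (Cons x xs)
  define n where "n = length xs"
  define c where "c a = (- 1) ^ card {b \<in> {..n}. b < a} * altpow ({..n} - {a}) xs" for a
  have expand: "altpow {..n} (y # xs) = (\<Sum>a\<le>n. c a * y ^ a)" for y
    by (simp add: c_def mult_ac)
  have "{..n} - {n} = {..<n}" by auto
  then have "c n \<noteq> 0"
    using Cons by (simp add: c_def n_def)
  then have fin: "finite {y. (\<Sum>a\<le>n. c a * y ^ a) = 0}"
    and bound: "card {y. (\<Sum>a\<le>n. c a * y ^ a) = 0} \<le> n"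
    using polyfun_rootbound[of c n n] by auto
  show ?case
  proof
    assume "altpow {..<length (x # xs)} (x # xs) = 0"
    then have "altpow {..n} (x # xs) = 0"
      by (simp only: n_def length_Cons lessThan_Suc_atMost)
    moreover have "altpow {..n} (y # xs) = 0" if "y \<in> set xs" for y
      using that by (intro altpow_not_distinct) auto
    ultimately have "set (x # xs) \<subseteq> {y. (\<Sum>a\<le>n. c a * y ^ a) = 0}"
      by (auto simp del: altpow.simps simp: expand)
    from card_mono[OF fin this] bound distinct_card[OF Cons.prems] show False
      by (simp add: n_def)
  qed
qed simp

section \<open>Rides\<close>

text \<open>\<open>ride_count D Ts s is v\<close> is the number of ways to travel from \<open>s\<close> to \<open>v\<close> on the trips \<open>is\<close>,
  listed from the last to the first, riding each of them along one contiguous segment.\<close>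
fun ride_count :: "('v, 'e) pre_digraph \<Rightarrow> 'e list list \<Rightarrow> 'v \<Rightarrow> nat list \<Rightarrow> 'v \<Rightarrow> real" where
  "ride_count D Ts s [] v = (if v = s then 1 else 0)"
| "ride_count D Ts s (i # is) v =
    (\<Sum>j<length (Ts ! i). if head D (Ts ! i ! j) = v
       then \<Sum>j'\<le>j. ride_count D Ts s is (tail D (Ts ! i ! j')) else 0)"

lemma ride_count_nonneg: "0 \<le> ride_count D Ts s is v"
  by (induction "is" arbitrary: v) (auto intro!: sum_nonneg)

text \<open>All summands are nonnegative, so a sum is positive exactly when one of its terms
  is.\<close>

lemma ride_count_Cons_pos_iff:
  "0 < ride_count D Ts s (i # is) v \<longleftrightarrow>
    (\<exists>j<length (Ts ! i). head D (Ts ! i ! j) = v \<and>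
      (\<exists>j'\<le>j. 0 < ride_count D Ts s is (tail D (Ts ! i ! j'))))"
proof -
  have pos_iff: "0 < sum f A \<longleftrightarrow> (\<exists>a\<in>A. 0 < f a)" if "finite A" "\<And>a. 0 \<le> f a"
    for A :: "nat set" and f :: "nat \<Rightarrow> real"
    using that by (metis order_less_le sum_nonneg sum_nonneg_eq_0_iff)
  show ?thesis
    by (subst ride_count.simps, subst pos_iff)
       (auto intro!: sum_nonneg simp: ride_count_nonneg pos_iff)
qed

section \<open>Rides and temporal paths\<close>

definition temporal_arc ::
  "('v, 'e) pre_digraph \<Rightarrow> ('e \<Rightarrow> real) \<Rightarrow> 'e list \<Rightarrow> real \<Rightarrow> nat \<Rightarrow> 'v temporal_edge" where
  "temporal_arc D wt T t0 i =
     (tail D (T ! i), head D (T ! i), t0 + (\<Sum>j<i. wt (T ! j)), wt (T ! i))"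

text \<open>The arrival is written as the prefix sum up to \<open>Suc i\<close>, so that it is
  syntactically the starting time of the next arc of the trip.\<close>

lemma temporal_arc_sel [simp]:
  "te_tail (temporal_arc D wt T t0 i) = tail D (T ! i)"
  "te_head (temporal_arc D wt T t0 i) = head D (T ! i)"
  "te_start (temporal_arc D wt T t0 i) = t0 + (\<Sum>j<i. wt (T ! j))"
  "te_arrival (temporal_arc D wt T t0 i) = t0 + (\<Sum>j<Suc i. wt (T ! j))"
  by (simp_all add: temporal_arc_def)

lemma trip_edges_eq: "trip_edges D wt T t0 = temporal_arc D wt T t0 ` {..<length T}"
  by (auto simp: trip_edges_def temporal_arc_def)

lemma cas_nth_Suc:
  "pre_digraph.cas D u p v \<Longrightarrow> Suc i < length p \<Longrightarrow> head D (p ! i) = tail D (p ! Suc i)"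
proof (induction p arbitrary: u i)
  case (Cons e p)
  then show ?case
    by (cases i; cases p) (auto simp: pre_digraph.cas.simps)
qed simp

context trip_network
begin

lemma trip_consecutive:
  "T \<in> set Ts \<Longrightarrow> Suc i < length T \<Longrightarrow> head D (T ! i) = tail D (T ! Suc i)"
  using trip_walk[of T] cas_nth_Suc unfolding pre_digraph.awalk_def by metis

lemma trip_arc: "T \<in> set Ts \<Longrightarrow> i < length T \<Longrightarrow> T ! i \<in> arcs D"
  using trip_walk[of T] unfolding pre_digraph.awalk_def by (meson nth_mem subset_eq)

lemma trip_prefix_weight_nonneg:
  "T \<in> set Ts \<Longrightarrow> i < length T \<Longrightarrow> 0 \<le> (\<Sum>j<i. wt (T ! j))"
  by (intro sum_nonneg) (meson lessThan_iff less_trans less_imp_le trip_arc weight_pos)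

text \<open>Since weights are positive, starting times determine the order of positions on a trip;
  this later shows that a path rides a trip forwards.\<close>

lemma trip_prefix_weight_less:
  assumes "T \<in> set Ts" "i < l" "l < length T"
  shows "(\<Sum>j<i. wt (T ! j)) < (\<Sum>j<l. wt (T ! j))"
proof -
  have "0 < wt (T ! j)" if "j < l" for j
    using assms that by (meson less_trans trip_arc weight_pos)
  then show ?thesis
    using assms by (intro sum_strict_mono2[where b = i]) (auto intro: less_imp_le)
qed

abbreviation arcs_of :: "(nat \<Rightarrow> real) \<Rightarrow> nat set \<Rightarrow> 'v temporal_edge set" where
  "arcs_of \<tau> K \<equiv> \<Union>i\<in>K. trip_edges D wt (Ts ! i) (\<tau> i)"

abbreviation follows :: "'v temporal_edge \<Rightarrow> 'v temporal_edge \<Rightarrow> bool" where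
  "follows e f \<equiv> te_head e = te_tail f \<and> te_arrival e \<le> te_start f"

text \<open>The head of the list is the trip ridden last. The induction hypothesis yields a path to
  its boarding node, and the trip is then started late enough to extend that path.\<close>

lemma ride_imp_temporal_path:
  assumes "distinct is" "set is \<subseteq> {..<length Ts}" "0 < ride_count D Ts s is v" "s \<in> verts D"
  shows "\<exists>\<tau> P. v \<in> verts D \<and> set P \<subseteq> arcs_of \<tau> (set is) \<and> successively follows P \<and>
    (if P = [] then s = v else te_tail (hd P) = s \<and> te_head (last P) = v)"
  using assms
proof (induction "is" arbitrary: v)
  case Nil
  then show ?case by (intro exI[of _ "\<lambda>_. 0"] exI[of _ "[]"]) (auto split: if_splits)
next
  case (Cons i "is")
  define T where "T = Ts ! i"
  have T: "T \<in> set Ts" using Cons.prems(2) by (auto simp: T_def)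
  obtain j j' where j: "j < length T" "head D (T ! j) = v" "j' \<le> j"
    and pos: "0 < ride_count D Ts s is (tail D (T ! j'))"
    using Cons.prems(3) unfolding ride_count_Cons_pos_iff T_def by blast
  obtain \<tau> P where P: "set P \<subseteq> arcs_of \<tau> (set is)" "successively follows P"
    "if P = [] then s = tail D (T ! j') else te_tail (hd P) = s \<and> te_head (last P) = tail D (T ! j')"
    using Cons.IH[of "tail D (T ! j')"] Cons.prems pos by auto
  \<comment> \<open>The whole trip departs when \<open>P\<close> arrives; its arc \<open>j'\<close>
    departs no earlier because prefix weights are nonnegative.\<close>
  define t0 where "t0 = (if P = [] then 0 else te_arrival (last P))"
  define \<tau>' where "\<tau>' = \<tau>(i := t0)"
  define Q where "Q = map (temporal_arc D wt T t0) [j'..<Suc j]"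
  have Q: "Q \<noteq> []" "hd Q = temporal_arc D wt T t0 j'" "last Q = temporal_arc D wt T t0 j"
    using j by (auto simp: Q_def hd_map last_map hd_append)
  have "set P \<subseteq> arcs_of \<tau>' (set (i # is))"
  proof -
    \<comment> \<open>Distinctness enters here: resetting the start of trip \<open>i\<close> does
      not move the edges already used.\<close>
    have "\<tau>' l = \<tau> l" if "l \<in> set is" for l
      using that Cons.prems(1) by (auto simp: \<tau>'_def)
    then have "arcs_of \<tau> (set is) = arcs_of \<tau>' (set is)"
      by (intro SUP_cong) auto
    then show ?thesis using P(1) by auto
  qed
  moreover have "set Q \<subseteq> arcs_of \<tau>' (set (i # is))"
    using j by (auto simp: Q_def trip_edges_eq \<tau>'_def T_def)
  moreover have "successively follows Q"
    using j trip_consecutive[OF T]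
    by (auto simp: Q_def successively_conv_nth nth_append simp del: upt_Suc)
  moreover have "follows (last P) (hd Q)" if "P \<noteq> []"
    using that P(3) Q(2) trip_prefix_weight_nonneg[OF T, of j'] j by (auto simp: t0_def)
  moreover have "v \<in> verts D"
    using j trip_arc[OF T, of j] by auto
  ultimately show ?case
    using P Q j
    by (intro exI[of _ \<tau>'] exI[of _ "P @ Q"])
       (auto simp: successively_append_iff hd_append split: if_splits)
qed

text \<open>Between its first and last use of a trip, a temporal path may as well stay on that trip.\<close>
lemma temporal_path_imp_ride:
  assumes "K \<subseteq> {..<length Ts}" "set P \<subseteq> arcs_of \<tau> K" "successively follows P"
    "if P = [] then s = v else te_tail (hd P) = s \<and> te_head (last P) = v"
  shows "\<exists>is. distinct is \<and> set is \<subseteq> K \<and> 0 < ride_count D Ts s is v"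
  using assms
proof (induction "length P" arbitrary: P K v rule: less_induct)
  case less
  show ?case
  proof (cases "P = []")
    case True
    then show ?thesis using less.prems by (intro exI[of _ "[]"]) auto
  next
    case False
    then have "last P \<in> arcs_of \<tau> K" using less.prems(2) last_in_set by blast
    then obtain i where i: "i \<in> K" "last P \<in> trip_edges D wt (Ts ! i) (\<tau> i)" by blast
    define T where "T = Ts ! i"
    have T: "T \<in> set Ts" using i(1) less.prems(1) by (auto simp: T_def)
    obtain j where j: "j < length T" "last P = temporal_arc D wt T (\<tau> i) j"
      using i(2) by (auto simp: trip_edges_eq T_def)
    \<comment> \<open>The path is cut at the first edge belonging to the trip of its last edge. The
      prefix avoids that trip, so the induction hypothesis applies with \<open>K - {i}\<close> and
      makes the resulting trips distinct.\<close>
    define l where "l = (LEAST l. l < length P \<and> P ! l \<in> trip_edges D wt T (\<tau> i))"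
    have "length P - 1 < length P \<and> P ! (length P - 1) \<in> trip_edges D wt T (\<tau> i)"
      using False i(2) by (simp add: last_conv_nth T_def)
    then have l: "l < length P" "P ! l \<in> trip_edges D wt T (\<tau> i)"
      unfolding l_def by (metis (mono_tags, lifting) LeastI)+
    have first: "P ! x \<notin> trip_edges D wt T (\<tau> i)" if "x < l" for x
      using that l(1) not_less_Least[of x] by (fastforce simp: l_def)
    obtain j' where j': "j' < length T" "P ! l = temporal_arc D wt T (\<tau> i) j'"
      using l(2) by (auto simp: trip_edges_eq)
    have start_mono: "te_start (P ! x) \<le> te_start (P ! y)" if "x \<le> y" "y < length P" for x y
      using that
    proof (induction y rule: dec_induct)
      case (step y)
      have "P ! y \<in> set P" using step by simp
      then have "P ! y \<in> arcs_of \<tau> K" using less.prems(2) by blast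
      then obtain i' z where "i' \<in> K" "z < length (Ts ! i')" "P ! y = temporal_arc D wt (Ts ! i') (\<tau> i') z"
        by (auto simp: trip_edges_eq)
      moreover from this have "0 < wt (Ts ! i' ! z)"
        using less.prems(1) by (auto intro!: weight_pos trip_arc)
      ultimately have "te_start (P ! y) \<le> te_arrival (P ! y)" by simp
      moreover have "te_arrival (P ! y) \<le> te_start (P ! Suc y)"
        using less.prems(3) step by (auto simp: successively_conv_nth)
      ultimately show ?case using step by simp
    qed simp
    \<comment> \<open>Starting times do not decrease along the path and strictly increase along the
      trip, so boarding at \<open>j'\<close> precedes leaving at \<open>j\<close>.\<close>
    have "(\<Sum>z<j'. wt (T ! z)) \<le> (\<Sum>z<j. wt (T ! z))"
      using start_mono[of l "length P - 1"] l(1) j j' False by (simp add: last_conv_nth)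
    then have "j' \<le> j"
      using trip_prefix_weight_less[OF T, of j j'] j'(1) by (meson not_le)
    have prefix: "set (take l P) \<subseteq> arcs_of \<tau> (K - {i})"
    proof
      fix e assume "e \<in> set (take l P)"
      then obtain x where "x < length (take l P)" "e = take l P ! x"
        by (metis in_set_conv_nth)
      then have x: "x < l" "e = P ! x" "e \<in> set P"
        using l(1) by simp_all
      then have "e \<in> arcs_of \<tau> K" using less.prems(2) by blast
      with x first show "e \<in> arcs_of \<tau> (K - {i})" by (auto simp: T_def)
    qed
    have succ: "successively follows (take l P)"
      using less.prems(3) by (auto simp: successively_conv_nth)
    have ends: "if take l P = [] then s = tail D (T ! j')
      else te_tail (hd (take l P)) = s \<and> te_head (last (take l P)) = tail D (T ! j')"
    proof (cases "l = 0")
      case True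
      then show ?thesis using less.prems(4) j' False by (simp add: hd_conv_nth)
    next
      case nz: False
      have "te_head (P ! (l - 1)) = te_tail (P ! l)"
        using less.prems(3) l(1) nz by (auto simp: successively_conv_nth dest: spec[of _ "l - 1"])
      then show ?thesis using less.prems(4) j' False nz l(1)
        by (simp add: hd_conv_nth last_conv_nth)
    qed
    obtain "is" where "is": "distinct is" "set is \<subseteq> K - {i}"
      "0 < ride_count D Ts s is (tail D (T ! j'))"
      using less.hyps[of "take l P" "K - {i}", OF _ _ prefix succ ends] less.prems(1) l(1) by auto
    have "head D (T ! j) = v" using less.prems(4) False j by simp
    then have "0 < ride_count D Ts s (i # is) v"
      unfolding ride_count_Cons_pos_iff using "is"(3) j(1) \<open>j' \<le> j\<close> by (auto simp: T_def)
    then show ?thesis using "is" i(1) by (intro exI[of _ "i # is"]) auto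
  qed
qed

text \<open>This eliminates time: the right-hand side mentions neither weights nor a
  temporalisation.\<close>

theorem o2o_rtt_iff_ride:
  assumes "s \<in> verts D"
  shows "o2o_rtt D wt Ts s t k \<longleftrightarrow>
    (\<exists>is. distinct is \<and> set is \<subseteq> {..<length Ts} \<and> length is \<le> k \<and> 0 < ride_count D Ts s is t)"
proof
  assume "o2o_rtt D wt Ts s t k"
  then obtain \<tau> P K where *: "temporal_path (induced_temporal_graph D wt Ts \<tau>) s P t"
    "K \<subseteq> {..<length Ts}" "card K \<le> k" "set P \<subseteq> arcs_of \<tau> K"
    unfolding o2o_rtt_def reachable_def by blast
  then obtain "is" where "is": "distinct is" "set is \<subseteq> K" "0 < ride_count D Ts s is t"
    using temporal_path_imp_ride[of K P \<tau> s t] by (auto simp: temporal_path_def)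
  have "length is \<le> card K"
    using "is" *(2) by (metis card_mono distinct_card finite_lessThan finite_subset)
  with "is" * show "\<exists>is. distinct is \<and> set is \<subseteq> {..<length Ts} \<and> length is \<le> k \<and> 0 < ride_count D Ts s is t"
    by (meson order_trans)
next
  assume "\<exists>is. distinct is \<and> set is \<subseteq> {..<length Ts} \<and> length is \<le> k \<and> 0 < ride_count D Ts s is t"
  then obtain "is" where "is": "distinct is" "set is \<subseteq> {..<length Ts}" "length is \<le> k"
    "0 < ride_count D Ts s is t" by blast
  obtain \<tau> P where "t \<in> verts D" "set P \<subseteq> arcs_of \<tau> (set is)" "successively follows P"
    "if P = [] then s = t else te_tail (hd P) = s \<and> te_head (last P) = t"
    using ride_imp_temporal_path[OF "is"(1,2,4) assms] by blast
  then have "reachable D wt Ts k \<tau> s t"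
    unfolding reachable_def temporal_path_def induced_temporal_graph_def using assms "is"
    by (intro exI[of _ P] exI[of _ "set is"]) (auto simp: distinct_card)
  then show "o2o_rtt D wt Ts s t k"
    unfolding o2o_rtt_def by blast
qed

end

section \<open>Sums of squared determinants over rides\<close>

text \<open>Summing the product of two generalised Vandermonde determinants over all rides: on the diagonal
  \<open>A = B\<close> no cancellation is possible, so a positive value certifies a ride on distinct trips.\<close>
definition ride_gram ::
  "('v, 'e) pre_digraph \<Rightarrow> 'e list list \<Rightarrow> 'v \<Rightarrow> nat set \<Rightarrow> nat set \<Rightarrow> 'v \<Rightarrow> real" where
  "ride_gram D Ts s A B v =
     (\<Sum>is | set is \<subseteq> {..<length Ts} \<and> length is = card A.
        ride_count D Ts s is v * altpow A (map real is) * altpow B (map real is))"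

abbreviation altsign :: "nat set \<Rightarrow> nat \<Rightarrow> real" where
  "altsign A a \<equiv> (- 1) ^ card {b \<in> A. b < a}"

text \<open>The list is split at its head, the trip ridden last: the ride count is unfolded once,
  both determinants are expanded along their first columns, and the sums are exchanged. For
  \<open>A = {}\<close> only the empty ride remains.\<close>

lemma ride_gram_rec:
  assumes "finite A" "finite B"
  shows "ride_gram D Ts s A B v = (if A = {} \<and> B = {} \<and> v = s then 1 else 0) +
    (\<Sum>i<length Ts. \<Sum>j<length (Ts ! i). if head D (Ts ! i ! j) = v
       then \<Sum>j'\<le>j. \<Sum>a\<in>A. \<Sum>b\<in>B. altsign A a * real i ^ a * (altsign B b * real i ^ b) *
         ride_gram D Ts s (A - {a}) (B - {b}) (tail D (Ts ! i ! j'))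
       else 0)"
proof (cases "A = {}")
  case True
  then have "{is. set is \<subseteq> {..<length Ts} \<and> length is = card A} = {[]}" by auto
  then show ?thesis using True by (simp add: ride_gram_def cong: if_cong)
next
  case False
  define L where "L l = {is. set is \<subseteq> {..<length Ts} \<and> length is = l}" for l
  obtain l where l: "card A = Suc l"
    using False assms by (metis card_eq_0_iff not0_implies_Suc)
  have L_Suc: "sum f (L (Suc l)) = (\<Sum>i<length Ts. \<Sum>is\<in>L l. f (i # is))" for f :: "nat list \<Rightarrow> real"
  proof -
    have "L (Suc l) = (\<lambda>(i, is). i # is) ` ({..<length Ts} \<times> L l)"
      by (force simp: L_def length_Suc_conv image_iff)
    then show ?thesis
      by (simp add: sum.reindex inj_on_def sum.cartesian_product split_def)
  qed
  have gram: "ride_gram D Ts s (A - {a}) B' u =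
    (\<Sum>is\<in>L l. ride_count D Ts s is u * altpow (A - {a}) (map real is) * altpow B' (map real is))"
    if "a \<in> A" for a B' u
    using that l assms by (simp add: ride_gram_def L_def)
  \<comment> \<open>Total contribution of the rides that board trip \<open>i\<close> at
    \<open>u\<close> as their last trip; the determinants already include the column of
    \<open>i\<close>.\<close>
  define R where "R i u = (\<Sum>is\<in>L l. ride_count D Ts s is u * altpow A (map real (i # is)) * altpow B (map real (i # is)))"
    for i u
  have R: "R i u = (\<Sum>a\<in>A. \<Sum>b\<in>B. altsign A a * real i ^ a * (altsign B b * real i ^ b) *
         ride_gram D Ts s (A - {a}) (B - {b}) u)" for i u
  proof -
    have "R i u = (\<Sum>is\<in>L l. \<Sum>a\<in>A. \<Sum>b\<in>B. altsign A a * real i ^ a * (altsign B b * real i ^ b) *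
      (ride_count D Ts s is u * altpow (A - {a}) (map real is) * altpow (B - {b}) (map real is)))"
      unfolding R_def
      by (intro sum.cong refl) (simp add: sum_distrib_left sum_distrib_right sum_product mult_ac)
    also have "\<dots> = (\<Sum>a\<in>A. \<Sum>b\<in>B. \<Sum>is\<in>L l. altsign A a * real i ^ a * (altsign B b * real i ^ b) *
      (ride_count D Ts s is u * altpow (A - {a}) (map real is) * altpow (B - {b}) (map real is)))"
      by (subst sum.swap, rule sum.cong[OF refl], rule sum.swap)
    finally show ?thesis
      by (simp add: gram sum_distrib_left)
  qed
  have "ride_gram D Ts s A B v =
    (\<Sum>i<length Ts. \<Sum>is\<in>L l. ride_count D Ts s (i # is) v *
        altpow A (map real (i # is)) * altpow B (map real (i # is)))"
    unfolding ride_gram_def l L_def[symmetric] L_Suc by simp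
  also have "\<dots> = (\<Sum>i<length Ts. \<Sum>j<length (Ts ! i). if head D (Ts ! i ! j) = v
       then \<Sum>j'\<le>j. R i (tail D (Ts ! i ! j')) else 0)"
  proof (rule sum.cong[OF refl])
    fix i
    \<comment> \<open>The determinants do not depend on where trip \<open>i\<close> is boarded or
      left, so they pass through the sums over positions as one factor.\<close>
    define c where "c is = altpow A (map real (i # is)) * altpow B (map real (i # is))" for "is"
    have "(\<Sum>is\<in>L l. ride_count D Ts s (i # is) v * c is) =
      (\<Sum>is\<in>L l. \<Sum>j<length (Ts ! i). if head D (Ts ! i ! j) = v
        then \<Sum>j'\<le>j. ride_count D Ts s is (tail D (Ts ! i ! j')) * c is else 0)"
      by (auto simp: sum_distrib_right intro!: sum.cong)
    also have "\<dots> = (\<Sum>j<length (Ts ! i). \<Sum>is\<in>L l. if head D (Ts ! i ! j) = v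
        then \<Sum>j'\<le>j. ride_count D Ts s is (tail D (Ts ! i ! j')) * c is else 0)"
      by (rule sum.swap)
    also have "\<dots> = (\<Sum>j<length (Ts ! i). if head D (Ts ! i ! j) = v
       then \<Sum>j'\<le>j. R i (tail D (Ts ! i ! j')) else 0)"
    proof (intro sum.cong refl)
      fix j
      show "(\<Sum>is\<in>L l. if head D (Ts ! i ! j) = v
          then \<Sum>j'\<le>j. ride_count D Ts s is (tail D (Ts ! i ! j')) * c is else 0) =
        (if head D (Ts ! i ! j) = v then \<Sum>j'\<le>j. R i (tail D (Ts ! i ! j')) else 0)"
        unfolding R_def by (subst sum.swap) (simp add: c_def mult.assoc)
    qed
    finally show "(\<Sum>is\<in>L l. ride_count D Ts s (i # is) v *
        altpow A (map real (i # is)) * altpow B (map real (i # is))) =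
      (\<Sum>j<length (Ts ! i). if head D (Ts ! i ! j) = v
       then \<Sum>j'\<le>j. R i (tail D (Ts ! i ! j')) else 0)"
      by (simp only: c_def mult.assoc)
  qed
  finally show ?thesis
    using False by (simp add: R cong: if_cong)
qed

text \<open>On the diagonal each summand is a nonnegative count times a square.\<close>

lemma ride_gram_pos_iff:
  "0 < ride_gram D Ts s A A v \<longleftrightarrow>
    (\<exists>is. set is \<subseteq> {..<length Ts} \<and> length is = card A \<and>
      0 < ride_count D Ts s is v \<and> altpow A (map real is) \<noteq> 0)"
proof -
  let ?L = "{is. set is \<subseteq> {..<length Ts} \<and> length is = card A}"
  let ?f = "\<lambda>is. ride_count D Ts s is v * altpow A (map real is) * altpow A (map real is)"
  have "finite ?L" by (rule finite_lists_length_eq) simp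
  moreover have nonneg: "0 \<le> ?f is" for "is"
    using ride_count_nonneg[of D Ts s "is" v] by (simp add: mult.assoc)
  ultimately have "0 < sum ?f ?L \<longleftrightarrow> (\<exists>is\<in>?L. ?f is \<noteq> 0)"
    by (metis (no_types, lifting) order_less_le sum_nonneg sum_nonneg_eq_0_iff)
  then show ?thesis
    using ride_count_nonneg[of D Ts s _ v] by (auto simp: ride_gram_def less_le)
qed

text \<open>For distinct trips the initial segment of exponents gives an ordinary Vandermonde
  determinant, which is nonzero. Conversely, a nonzero minor for any exponent set forces distinct
  trips, and \<open>card A\<close> bounds their number by \<open>k\<close>.\<close>

theorem (in trip_network) o2o_rtt_iff_ride_gram:
  assumes "s \<in> verts D"
  shows "o2o_rtt D wt Ts s t k \<longleftrightarrow> (\<exists>A\<subseteq>{..<k}. 0 < ride_gram D Ts s A A t)"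
proof
  assume "o2o_rtt D wt Ts s t k"
  then obtain "is" where "is": "distinct is" "set is \<subseteq> {..<length Ts}" "length is \<le> k"
    "0 < ride_count D Ts s is t"
    unfolding o2o_rtt_iff_ride[OF assms] by blast
  then have "0 < ride_gram D Ts s {..<length is} {..<length is} t"
    unfolding ride_gram_pos_iff using altpow_distinct[of "map real is"]
    by (intro exI[of _ "is"]) (auto simp: distinct_map)
  with "is"(3) show "\<exists>A\<subseteq>{..<k}. 0 < ride_gram D Ts s A A t"
    by (intro exI[of _ "{..<length is}"]) auto
next
  assume "\<exists>A\<subseteq>{..<k}. 0 < ride_gram D Ts s A A t"
  then obtain A "is" where A: "A \<subseteq> {..<k}" and "is": "set is \<subseteq> {..<length Ts}" "length is = card A"
    "0 < ride_count D Ts s is t" "altpow A (map real is) \<noteq> 0"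
    unfolding ride_gram_pos_iff by blast
  have "finite A" using A finite_subset by blast
  then have "distinct is"
    using altpow_not_distinct "is"(4) by (metis distinct_map)
  moreover have "length is \<le> k"
    using card_mono[OF finite_lessThan A] "is"(2) by simp
  ultimately show "o2o_rtt D wt Ts s t k"
    unfolding o2o_rtt_iff_ride[OF assms] using "is" by blast
qed

section \<open>Timed weakest preconditions\<close>

text \<open>Total correctness with an upper bound on the time; a bound instead of the exact time
  lets branches of different cost be joined.\<close>

definition wp :: "nat \<Rightarrow> program \<Rightarrow> nat \<Rightarrow> (state \<Rightarrow> bool) \<Rightarrow> state \<Rightarrow> bool" where
  "wp w p n Q \<sigma> \<longleftrightarrow> (\<exists>m \<sigma>'. exec w p \<sigma> m \<sigma>' \<and> m \<le> n \<and> Q \<sigma>')"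

lemma wp_mono:
  "wp w p m Q \<sigma> \<Longrightarrow> m \<le> n \<Longrightarrow> (\<And>\<sigma>'. Q \<sigma>' \<Longrightarrow> R \<sigma>') \<Longrightarrow> wp w p n R \<sigma>"
  unfolding wp_def by (meson order_trans)

lemma wp_le: "wp w p m Q \<sigma> \<Longrightarrow> m \<le> n \<Longrightarrow> wp w p n Q \<sigma>"
  by (rule wp_mono)

lemma wp_conseq: "wp w p m Q \<sigma> \<Longrightarrow> (\<And>\<sigma>'. Q \<sigma>' \<Longrightarrow> R \<sigma>') \<Longrightarrow> wp w p m R \<sigma>"
  unfolding wp_def by blast

lemma wp_Seq:
  "wp w p m (wp w q n Q) \<sigma> \<Longrightarrow> wp w (Seq p q) (m + n) Q \<sigma>"
  unfolding wp_def by (blast intro: exec.Seq add_mono)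

lemma wp_Cond:
  assumes "holds b \<sigma> \<Longrightarrow> wp w p m Q \<sigma>" "\<not> holds b \<sigma> \<Longrightarrow> wp w q n Q \<sigma>"
  shows "wp w (Cond b p q) (1 + max m n) Q \<sigma>"
proof -
  obtain l \<sigma>' where "exec w (if holds b \<sigma> then p else q) \<sigma> l \<sigma>'" "l \<le> max m n" "Q \<sigma>'"
    using assms unfolding wp_def by (cases "holds b \<sigma>") (auto simp: le_max_iff_disj)
  moreover from this have "exec w (Cond b p q) \<sigma> (1 + l) \<sigma>'"
    using exec.CondTrue exec.CondFalse by (metis (full_types))
  ultimately show ?thesis
    unfolding wp_def by (meson add_le_mono le_refl)
qed

text \<open>The invariant is indexed by the number of completed rounds. Each round pays one unit for
  its test, and the leading 1 pays for the final failing test.\<close>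

lemma wp_While:
  assumes step: "\<And>j \<sigma>. j < N \<Longrightarrow> I j \<sigma> \<Longrightarrow> holds b \<sigma> \<and> wp w p (c j) (I (Suc j)) \<sigma>"
    and exit: "\<And>\<sigma>. I N \<sigma> \<Longrightarrow> \<not> holds b \<sigma>"
    and init: "I 0 \<sigma>"
  shows "wp w (While b p) (1 + (\<Sum>j<N. 1 + c j)) (I N) \<sigma>"
proof -
  have "wp w (While b p) (1 + (\<Sum>j=l..<N. 1 + c j)) (I N) \<sigma>" if "l \<le> N" "I l \<sigma>" for l \<sigma>
    using that
  proof (induction l arbitrary: \<sigma> rule: inc_induct)
    case base
    then show ?case using exit exec.WhileFalse unfolding wp_def by fastforce
  next
    case (step l)
    obtain m \<sigma>' where 1: "holds b \<sigma>" "exec w p \<sigma> m \<sigma>'" "m \<le> c l" "I (Suc l) \<sigma>'"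
      using assms(1)[OF step(2) step.prems] unfolding wp_def by blast
    obtain m' \<sigma>'' where 2: "exec w (While b p) \<sigma>' m' \<sigma>''"
      "m' \<le> 1 + (\<Sum>j=Suc l..<N. 1 + c j)" "I N \<sigma>''"
      using step.IH[OF 1(4)] unfolding wp_def by blast
    show ?case
      unfolding wp_def using exec.WhileTrue[OF 1(1,2) 2(1)] 1(3) 2(2,3) step(2)
      by (intro exI conjI) (auto simp: sum.atLeast_Suc_lessThan)
  qed
  from this[of 0] init show ?thesis by (simp add: atLeast0LessThan)
qed

text \<open>The first instruction is a separate argument because a program cannot be empty; for the
  same reason idle branches below consist of a dummy \<open>Const\<close>.\<close>

fun block :: "instr \<Rightarrow> instr list \<Rightarrow> program" where
  "block i [] = Instr i"
| "block i (j # js) = Seq (Instr i) (block j js)"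

lemma wp_block:
  assumes "Q (fold (instr_step w) (i # is) \<sigma>)"
  shows "wp w (block i is) (Suc (length is)) Q \<sigma>"
proof -
  have "exec w (block i is) \<sigma> (Suc (length is)) (fold (instr_step w) (i # is) \<sigma>)"
  proof (induction "is" arbitrary: i \<sigma>)
    case Nil
    then show ?case using exec.Instr[of w i \<sigma>] by simp
  next
    case (Cons j js)
    then show ?case using exec.Seq[OF exec.Instr[of w i \<sigma>]] by fastforce
  qed
  with assms show ?thesis unfolding wp_def by blast
qed

section \<open>The program\<close>

text \<open>Word registers: 23, 2, 3 and 5 hold the numbers of nodes, arcs and trips and the target \<open>t\<close>; 6 holds
  \<open>2 ^ k\<close>; 7, 8, 9 and 10 hold 0, 1, 6 and the address of the first trip; 11 and 12 hold the masks
  \<open>A\<close> and \<open>B\<close>, whose single bits are scanned by 19 and 20; 13, 14 and 15 hold the read position, the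
  number and the end of the current trip; 17 and 18 hold the ends of the current arc. Real registers:
  0 and 8 hold 0 and 1, 2 the number of the trip, 3 the sum along the trip, 4 the value at the current
  arc, and 5 and 6 the signed powers. The table is kept in the real memory behind the weights.\<close>

definition column_body :: program where
  "column_body =
    Seq (block (Op And 21 12 20) [])
    (Seq (Cond (Eq 21 7) (block (Const 21 0) [])
      (block (Op Sub 16 11 19) [Op Mul 16 16 6, Op Sub 22 12 20, Op Add 16 16 22, Op Mul 16 16 23,
        Op Add 16 16 17, Op Add 16 16 2, RLoad 7 16, ROp RMul 7 6 7, ROp RAdd 4 4 7, ROp RSub 6 0 6]))
    (block (ROp RMul 6 6 2) [Op Add 20 20 20]))"

text \<open>The inner loop starts with the signed power of the row in real register 6, so both
  signed powers are accumulated in one product. Subtracting the zero in real register 0 serves as a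
  move.\<close>

definition row_body :: program where
  "row_body =
    Seq (block (Op And 21 11 19) [])
    (Seq (Cond (Eq 21 7) (block (Const 21 0) [])
      (Seq (block (ROp RSub 6 5 0) [Const 20 1])
      (Seq (While (Less 20 6) column_body)
      (block (ROp RSub 5 0 5) []))))
    (block (ROp RMul 5 5 2) [Op Add 19 19 19]))"

text \<open>Real register 3 accumulates the contributions of all boarding positions up to the
  current arc, so one scan of a trip serves every place to leave it.\<close>

definition arc_body :: program where
  "arc_body =
    Seq (block (Load 16 13) [Op Add 16 16 16, Op Add 16 16 9, Load 17 16, Op Add 16 16 8, Load 18 16,
      ROp RSub 4 0 0, ROp RSub 5 8 0, Const 19 1])
    (Seq (While (Less 19 6) row_body)
    (block (ROp RAdd 3 3 4) [Op Mul 16 11 6, Op Add 16 16 12, Op Mul 16 16 23, Op Add 16 16 18,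
      Op Add 16 16 2, RLoad 7 16, ROp RAdd 7 7 3, RStore 16 7, Op Add 13 13 8]))"

definition trip_body :: program where
  "trip_body =
    Seq (block (RCast 2 14) [Load 15 13, Op Add 13 13 8, Op Add 15 15 13, ROp RSub 3 0 0])
    (Seq (While (Less 13 15) arc_body)
    (block (Op Add 14 14 8) []))"

definition entry_body :: program where
  "entry_body =
    Seq (block (Op Add 13 10 7) [Const 14 0])
    (Seq (While (Less 14 3) trip_body)
    (block (Op Add 12 12 8) []))"

definition mask_body :: program where
  "mask_body =
    Seq (block (Const 12 0) [])
    (Seq (While (Less 12 6) entry_body)
    (Seq (block (Op Mul 16 11 6) [Op Add 16 16 11, Op Mul 16 16 23, Op Add 16 16 5, Op Add 16 16 2,
      RLoad 7 16])
    (Seq (Cond (RLess 0 7) (block (Const 0 1) []) (block (Const 16 0) []))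
    (block (Op Add 11 11 8) []))))"

text \<open>The shift computes \<open>2 ^ k\<close>, and the last store sets the entry of the empty
  ride, both masks 0 at node \<open>s\<close>, to 1.\<close>

definition ride_program :: program where
  "ride_program =
    Seq (block (Const 8 1) [Load 23 7, Load 2 8, Const 16 2, Load 3 16, Const 16 3, Load 4 16,
      Const 16 4, Load 5 16, Const 16 5, Load 6 16, Op Shl 6 8 6, Const 9 6, Op Add 10 2 2,
      Op Add 10 10 9, RCast 8 8, Op Add 16 4 2, RStore 16 8])
    (While (Less 11 6) mask_body)"

section \<open>Frame conditions, signs and word arithmetic\<close>

definition keeps :: "nat set \<Rightarrow> nat set \<Rightarrow> state \<Rightarrow> state \<Rightarrow> bool" where
  "keeps X Y \<sigma> \<sigma>' \<longleftrightarrow> wmem \<sigma>' = wmem \<sigma> \<and> rmem \<sigma>' = rmem \<sigma> \<and>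
    (\<forall>r. r \<notin> X \<longrightarrow> wreg \<sigma>' r = wreg \<sigma> r) \<and> (\<forall>r. r \<notin> Y \<longrightarrow> rreg \<sigma>' r = rreg \<sigma> r)"

text \<open>The sign of the Laplace expansion for the set of bits of \<open>A\<close>. Counting the
  set bits below \<open>a\<close> allows an update in every round: it flips after each set
  bit.\<close>

definition bit_sign :: "nat \<Rightarrow> nat \<Rightarrow> real" where
  "bit_sign A a = (- 1) ^ card {b. b < a \<and> bit A b}"

lemma bit_sign_0 [simp]: "bit_sign A 0 = 1"
  by (simp add: bit_sign_def)

lemma bit_sign_Suc [simp]: "bit_sign A (Suc a) = (if bit A a then - bit_sign A a else bit_sign A a)"
proof -
  have "{b. b < Suc a \<and> bit A b} = (if bit A a then insert a {b. b < a \<and> bit A b} else {b. b < a \<and> bit A b})"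
    by (auto simp: less_Suc_eq)
  then show ?thesis by (simp add: bit_sign_def)
qed

lemma bit_imp_le: "bit (A :: nat) a \<Longrightarrow> 2 ^ a \<le> A"
  by (rule ccontr) (simp add: bit_iff_odd)

lemma and_nat_le: "and x y \<le> (x :: nat)"
  by (simp add: and_nat_def nat_le_iff)

lemma mult_add_inject:
  fixes x :: nat
  assumes "x * n + u = y * n + v" "u < n" "v < n"
  shows "x = y \<and> u = v"
proof -
  have "(x * n + u) div n = x" "(x * n + u) mod n = u" "(y * n + v) div n = y" "(y * n + v) mod n = v"
    using assms(2,3) by auto
  then show ?thesis using assms(1) by metis
qed

lemma sub_word:
  assumes "y \<le> x" "x < 2 ^ w"
  shows "(x + 2 ^ w - y) mod 2 ^ w = x - (y :: nat)"
proof -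
  have "x + 2 ^ w - y = (x - y) + 2 ^ w" using assms by simp
  then show ?thesis using assms by (simp only: mod_add_self2) simp
qed

text \<open>\<open>W\<close> is the word memory, \<open>off i\<close> the address of the length word
  of trip \<open>i\<close>, and \<open>G\<close> the intended table, still arbitrary here. The
  assumptions \<open>fits\<close> keep word operations from wrapping around.\<close>

locale ride_table =
  fixes src dst :: "nat \<Rightarrow> nat" and Ts :: "nat list list" and n ma s t k w K :: nat
    and W :: "nat \<Rightarrow> nat" and off :: "nat \<Rightarrow> nat" and G :: "nat \<Rightarrow> nat \<Rightarrow> nat \<Rightarrow> real"
  assumes K: "K = 2 ^ k"
    and node: "s < n" "t < n"
    and arc: "\<And>i j. i < length Ts \<Longrightarrow> j < length (Ts ! i) \<Longrightarrow>
      Ts ! i ! j < ma \<and> src (Ts ! i ! j) < n \<and> dst (Ts ! i ! j) < n"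
    and header: "W 0 = n" "W (Suc 0) = ma" "W 2 = length Ts" "W 3 = s" "W 4 = t" "W 5 = k"
    and arc_words: "\<And>e. e < ma \<Longrightarrow> W (2 * e + 6) = src e \<and> W (2 * e + 7) = dst e"
    and off: "off 0 = 2 * ma + 6" "\<And>i. i < length Ts \<Longrightarrow> off (Suc i) = off i + 1 + length (Ts ! i)"
    and trip_words: "\<And>i. i < length Ts \<Longrightarrow> W (off i) = length (Ts ! i)"
      "\<And>i j. i < length Ts \<Longrightarrow> j < length (Ts ! i) \<Longrightarrow> W (off i + 1 + j) = Ts ! i ! j"
    and fits: "off (length Ts) < 2 ^ w" "length Ts < 2 ^ w" "K * K * n + ma < 2 ^ w" "8 < (2 :: nat) ^ w"
begin

definition gram_row :: "nat \<Rightarrow> nat \<Rightarrow> real \<Rightarrow> nat \<Rightarrow> nat \<Rightarrow> real" where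
  "gram_row A B x u a = (\<Sum>b<k. if bit B b then bit_sign B b * x ^ b * G (A - 2 ^ a) (B - 2 ^ b) u else 0)"

definition gram_step :: "nat \<Rightarrow> nat \<Rightarrow> real \<Rightarrow> nat \<Rightarrow> real" where
  "gram_step A B x u = (\<Sum>a<k. if bit A a then bit_sign A a * x ^ a * gram_row A B x u a else 0)"

definition adr :: "nat \<Rightarrow> nat \<Rightarrow> nat \<Rightarrow> nat" where
  "adr A B u = (A * K + B) * n + u + ma"

text \<open>Bounds for every intermediate value of the address computation, so that all reductions
  modulo \<open>2 ^ w\<close> disappear.\<close>

lemma adr_less:
  assumes "A < K" "B < K" "u < n"
  shows "A * K < 2 ^ w" "A * K + B < 2 ^ w" "(A * K + B) * n < 2 ^ w" "(A * K + B) * n + u < 2 ^ w"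
    "(A * K + B) * n + u + ma < 2 ^ w" "A < 2 ^ w" "B < 2 ^ w" "K < 2 ^ w" "ma < 2 ^ w" "n < 2 ^ w"
proof -
  have 1: "A * K + B < K * K"
  proof -
    have "Suc A * K \<le> K * K" using assms(1) by (intro mult_le_mono1) simp
    then show ?thesis using assms(2) by simp
  qed
  have 2: "(A * K + B) * n + u < K * K * n"
  proof -
    have "Suc (A * K + B) * n \<le> K * K * n" using 1 by (intro mult_le_mono1) simp
    then show ?thesis using assms(3) by simp
  qed
  have 3: "K \<le> K * K" "K * K \<le> K * K * n" "n \<le> K * K * n" using assms by auto
  have 4: "A * K + B \<le> (A * K + B) * n" using assms(3) by simp
  show "A * K < 2 ^ w" "A * K + B < 2 ^ w" "(A * K + B) * n < 2 ^ w" "(A * K + B) * n + u < 2 ^ w"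
    "(A * K + B) * n + u + ma < 2 ^ w" "A < 2 ^ w" "B < 2 ^ w" "K < 2 ^ w" "ma < 2 ^ w" "n < 2 ^ w"
    using 1 2 3 4 fits assms by linarith+
qed

definition env :: "state \<Rightarrow> bool" where
  "env \<sigma> \<longleftrightarrow> wmem \<sigma> = W \<and> wreg \<sigma> 23 = n \<and> wreg \<sigma> 2 = ma \<and> wreg \<sigma> 3 = length Ts \<and> wreg \<sigma> 5 = t \<and>
    wreg \<sigma> 6 = K \<and> wreg \<sigma> 7 = 0 \<and> wreg \<sigma> 8 = 1 \<and> wreg \<sigma> 9 = 6 \<and> wreg \<sigma> 10 = 2 * ma + 6 \<and>
    rreg \<sigma> 0 = 0 \<and> rreg \<sigma> 8 = 1"

lemma pow_le_K: "a \<le> k \<Longrightarrow> 2 ^ a \<le> K"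
  by (simp add: K)

lemma Suc_le_pow_K: "a < k \<Longrightarrow> 2 * 2 ^ a \<le> K \<and> 0 < (2 :: nat) ^ a"
  using pow_le_K[of "Suc a"] by simp

lemma K_less: "K < 2 ^ w"
  using adr_less(8)[of 0 0 s] node by (simp add: K)

section \<open>The two loops over exponents\<close>

lemma column_loop:
  assumes env: "env \<sigma>" and regs: "wreg \<sigma> 11 = A" "wreg \<sigma> 12 = B" "wreg \<sigma> 17 = u" "wreg \<sigma> 19 = 2 ^ a"
      "wreg \<sigma> 20 = 1" "rreg \<sigma> 2 = x"
    and A: "A < K" "B < K" "u < n" "bit A a"
    and table: "\<And>b. bit B b \<Longrightarrow> rmem \<sigma> (adr (A - 2 ^ a) (B - 2 ^ b) u) = G (A - 2 ^ a) (B - 2 ^ b) u"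
  shows "wp w (While (Less 20 6) column_body) (1 + 16 * k)
    (\<lambda>\<sigma>'. keeps {16, 20, 21, 22} {4, 6, 7} \<sigma> \<sigma>' \<and>
      rreg \<sigma>' 4 = rreg \<sigma> 4 + rreg \<sigma> 6 * gram_row A B x u a) \<sigma>"
proof -
  \<comment> \<open>Real register 6 is the factor handed over by the row times the signed power of
    the current column, and real register 4 the part of the expansion summed so far.\<close>
  define I where "I q \<sigma>' \<longleftrightarrow> keeps {16, 20, 21, 22} {4, 6, 7} \<sigma> \<sigma>' \<and> wreg \<sigma>' 20 = 2 ^ q \<and>
    rreg \<sigma>' 6 = rreg \<sigma> 6 * bit_sign B q * x ^ q \<and>
    rreg \<sigma>' 4 = rreg \<sigma> 4 + rreg \<sigma> 6 *
      (\<Sum>b<q. if bit B b then bit_sign B b * x ^ b * G (A - 2 ^ a) (B - 2 ^ b) u else 0)" for q \<sigma>'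
  have "wp w (While (Less 20 6) column_body) (1 + (\<Sum>q<k. 1 + 15)) (I k) \<sigma>"
  proof (rule wp_While)
    fix q \<sigma>' assume q: "q < k" and I: "I q \<sigma>'"
    have pow: "2 ^ q < K" "2 * 2 ^ q < (2 :: nat) ^ w" "1 < (2 :: nat) ^ w"
      using Suc_le_pow_K[OF q] K_less fits(4) by linarith+
    define A' where "A' = A - 2 ^ a"
    define B' where "B' = B - 2 ^ q"
    have "A' < K" "B' < K" using A by (auto simp: A'_def B'_def)
    note bounds = adr_less[OF this A(3)] adr_less[OF A(1-3)]
    have sub: "(A + 2 ^ w - 2 ^ a) mod 2 ^ w = A'" "bit B q \<Longrightarrow> (B + 2 ^ w - 2 ^ q) mod 2 ^ w = B'"
      using A bounds bit_imp_le by (auto simp: A'_def B'_def sub_word)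
    have entry: "bit B q \<Longrightarrow> rmem \<sigma> ((A' * K + B') * n + u + ma) = G A' B' u"
      using table[of q] by (simp add: A'_def B'_def adr_def)
    have kept: "wmem \<sigma>' = W" "rmem \<sigma>' = rmem \<sigma>" "\<And>r. r \<notin> {16, 20, 21, 22} \<Longrightarrow> wreg \<sigma>' r = wreg \<sigma> r"
      "\<And>r. r \<notin> {4, 6, 7} \<Longrightarrow> rreg \<sigma>' r = rreg \<sigma> r"
      using I env by (auto simp: I_def keeps_def env_def)
    note regs' = regs env[unfolded env_def]
    have and_word: "(and B (2 ^ q)) mod 2 ^ w = and B (2 ^ q)"
      by (rule mod_less) (metis A(2) K_less and_nat_le le_less_trans less_trans)
    have regs_q: "wreg \<sigma>' 20 = 2 ^ q" "rreg \<sigma>' 6 = rreg \<sigma> 6 * bit_sign B q * x ^ q"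
      "rreg \<sigma>' 4 = rreg \<sigma> 4 + rreg \<sigma> 6 *
        (\<Sum>b<q. if bit B b then bit_sign B b * x ^ b * G (A - 2 ^ a) (B - 2 ^ b) u else 0)"
      using I by (auto simp: I_def)
    have "(2 ^ q + 2 ^ q) mod 2 ^ w = (2 * 2 ^ q :: nat)"
      using pow by simp
    note exec = this kept regs' regs_q and_word and_exp_eq_0_iff_not_bit bounds pow sub entry A'_def[symmetric] B'_def[symmetric]
    show "holds (Less 20 6) \<sigma>' \<and> wp w column_body 15 (I (Suc q)) \<sigma>'"
    proof
      show "holds (Less 20 6) \<sigma>'"
        using pow by (simp add: kept regs' regs_q)
      show "wp w column_body 15 (I (Suc q)) \<sigma>'"
        unfolding column_body_def
        apply (rule wp_le, rule wp_Seq, rule wp_block, rule wp_Seq, rule wp_Cond, rule wp_block, rule wp_block)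
        apply (rule_tac [2] wp_block, rule_tac [2] wp_block)
        apply (simp add: I_def keeps_def exec)
        apply (simp add: I_def keeps_def exec)
         apply (simp add: algebra_simps)
        apply simp
        done
    qed
  qed (use regs in \<open>auto simp: I_def keeps_def K env[unfolded env_def]\<close>)
  then show ?thesis
    by (rule wp_mono) (auto simp: I_def gram_row_def)
qed

lemma w_pos: "0 < w"
  using fits(4) by (cases w) auto

lemma row_loop:
  assumes env: "env \<sigma>" and regs: "wreg \<sigma> 11 = A" "wreg \<sigma> 12 = B" "wreg \<sigma> 17 = u" "wreg \<sigma> 19 = 1"
      "rreg \<sigma> 2 = x" "rreg \<sigma> 5 = 1"
    and A: "A < K" "B < K" "u < n"
    and table: "\<And>a b. bit A a \<Longrightarrow> bit B b \<Longrightarrow>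
      rmem \<sigma> (adr (A - 2 ^ a) (B - 2 ^ b) u) = G (A - 2 ^ a) (B - 2 ^ b) u"
  shows "wp w (While (Less 19 6) row_body) (1 + (9 + 16 * k) * k)
    (\<lambda>\<sigma>'. keeps {16, 19, 20, 21, 22} {4, 5, 6, 7} \<sigma> \<sigma>' \<and>
      rreg \<sigma>' 4 = rreg \<sigma> 4 + gram_step A B x u) \<sigma>"
proof -
  define I where "I p \<sigma>' \<longleftrightarrow> keeps {16, 19, 20, 21, 22} {4, 5, 6, 7} \<sigma> \<sigma>' \<and> wreg \<sigma>' 19 = 2 ^ p \<and>
    rreg \<sigma>' 5 = bit_sign A p * x ^ p \<and>
    rreg \<sigma>' 4 = rreg \<sigma> 4 +
      (\<Sum>a<p. if bit A a then bit_sign A a * x ^ a * gram_row A B x u a else 0)" for p \<sigma>'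
  have "wp w (While (Less 19 6) row_body) (1 + (\<Sum>p<k. 1 + (8 + 16 * k))) (I k) \<sigma>"
  proof (rule wp_While)
    fix p \<sigma>' assume p: "p < k" and I: "I p \<sigma>'"
    have pow: "2 ^ p < K" "2 * 2 ^ p < (2 :: nat) ^ w" "1 < (2 :: nat) ^ w"
      using Suc_le_pow_K[OF p] K_less fits(4) by linarith+
    have kept: "wmem \<sigma>' = W" "rmem \<sigma>' = rmem \<sigma>" "\<And>r. r \<notin> {16, 19, 20, 21, 22} \<Longrightarrow> wreg \<sigma>' r = wreg \<sigma> r"
      "\<And>r. r \<notin> {4, 5, 6, 7} \<Longrightarrow> rreg \<sigma>' r = rreg \<sigma> r"
      using I env by (auto simp: I_def keeps_def env_def)
    note regs' = regs env[unfolded env_def]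
    have and_word: "(and A (2 ^ p)) mod 2 ^ w = and A (2 ^ p)"
      by (rule mod_less) (metis A(1) K_less and_nat_le le_less_trans less_trans)
    have regs_p: "wreg \<sigma>' 19 = 2 ^ p" "rreg \<sigma>' 5 = bit_sign A p * x ^ p"
      "rreg \<sigma>' 4 = rreg \<sigma> 4 +
        (\<Sum>a<p. if bit A a then bit_sign A a * x ^ a * gram_row A B x u a else 0)"
      using I by (auto simp: I_def)
    have "(2 ^ p + 2 ^ p) mod 2 ^ w = (2 * 2 ^ p :: nat)"
      using pow by simp
    note exec = this kept regs' regs_p and_word and_exp_eq_0_iff_not_bit pow w_pos
    \<comment> \<open>The state at the entry of the inner loop, where real register 6 is a copy of
      the signed power of row \<open>p\<close>.\<close>
    let ?s = "fold (instr_step w) [ROp RSub 6 5 0, Const 20 1] (fold (instr_step w) [Op And 21 11 19] \<sigma>')"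
    have loop: "wp w (While (Less 20 6) column_body) (1 + 16 * k)
      (\<lambda>\<sigma>''. keeps {16, 20, 21, 22} {4, 6, 7} ?s \<sigma>'' \<and>
        rreg \<sigma>'' 4 = rreg ?s 4 + rreg ?s 6 * gram_row A B x u p) ?s" if "bit A p"
      by (rule column_loop) (use that A in \<open>simp_all add: env_def exec table\<close>)
    have s: "wmem ?s = W" "rmem ?s = rmem \<sigma>" "\<And>r. r \<notin> {16, 19, 20, 21, 22} \<Longrightarrow> wreg ?s r = wreg \<sigma> r"
      "wreg ?s 19 = 2 ^ p"
      "\<And>r. r \<notin> {4, 5, 6, 7} \<Longrightarrow> rreg ?s r = rreg \<sigma> r"
      "rreg ?s 5 = bit_sign A p * x ^ p" "rreg ?s 6 = bit_sign A p * x ^ p"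
      "rreg ?s 4 = rreg \<sigma> 4 +
        (\<Sum>a<p. if bit A a then bit_sign A a * x ^ a * gram_row A B x u a else 0)"
      by (simp_all add: exec)
    show "holds (Less 19 6) \<sigma>' \<and> wp w row_body (8 + 16 * k) (I (Suc p)) \<sigma>'"
    proof
      show "holds (Less 19 6) \<sigma>'"
        using pow by (simp add: exec)
      have I_Suc: "I (Suc p) (fold (instr_step w) [ROp RMul 5 5 2, Op Add 19 19 19]
          (fold (instr_step w) [ROp RSub 5 0 5] \<sigma>''))"
        if "bit A p" and post: "keeps {16, 20, 21, 22} {4, 6, 7} ?s \<sigma>'' \<and>
        rreg \<sigma>'' 4 = rreg ?s 4 + rreg ?s 6 * gram_row A B x u p" for \<sigma>''
      proof -
        have "wmem \<sigma>'' = W" "rmem \<sigma>'' = rmem \<sigma>" "\<And>r. r \<notin> {16, 19, 20, 21, 22} \<Longrightarrow> wreg \<sigma>'' r = wreg \<sigma> r"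
          "wreg \<sigma>'' 19 = 2 ^ p" "\<And>r. r \<notin> {4, 5, 6, 7} \<Longrightarrow> rreg \<sigma>'' r = rreg \<sigma> r"
          "rreg \<sigma>'' 5 = bit_sign A p * x ^ p"
          "rreg \<sigma>'' 4 = rreg \<sigma> 4 +
            (\<Sum>a<p. if bit A a then bit_sign A a * x ^ a * gram_row A B x u a else 0) +
            bit_sign A p * x ^ p * gram_row A B x u p"
          using post s by (simp_all add: keeps_def del: fold_simps)
        with that(1) show ?thesis
          by (simp add: I_def keeps_def exec algebra_simps)
      qed
      show "wp w row_body (8 + 16 * k) (I (Suc p)) \<sigma>'"
        unfolding row_body_def
        apply (rule wp_le, rule wp_Seq, rule wp_block, rule wp_Seq, rule wp_Cond, rule wp_block, rule wp_block)
        apply (rule_tac [2] wp_Seq, rule_tac [2] wp_block, rule_tac [2] wp_Seq, rule_tac [2] wp_conseq,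
            rule_tac [2] loop, rule_tac [3] wp_block, rule_tac [3] wp_block, rule_tac [3] I_Suc)
        apply (simp_all add: I_def keeps_def exec)
        done
    qed
  qed (use regs in \<open>auto simp: I_def keeps_def K env[unfolded env_def]\<close>)
  then show ?thesis
    by (rule wp_mono) (auto simp: I_def gram_step_def)
qed

section \<open>Addresses and the partly filled table\<close>

lemma off_mono: "i \<le> length Ts \<Longrightarrow> off i \<le> off (length Ts)"
  by (induction i rule: inc_induct) (auto simp: off(2))

lemma off_bounds:
  assumes "i < length Ts" "j < length (Ts ! i)"
  shows "off i + 1 + j < 2 ^ w" "off i + 1 + j + 1 < 2 ^ w"
  using off_mono[of "Suc i"] off(2)[of i] assms fits(1) by simp_all

lemma arc_bounds:
  assumes "e < ma"
  shows "2 * e + 7 < 2 ^ w"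
  using off_mono[of 0] off(1) assms fits(1) by simp

lemma adr_eq_iff:
  assumes "B < K" "B' < K" "u < n" "v < n"
  shows "adr A B u = adr A' B' v \<longleftrightarrow> A = A' \<and> B = B' \<and> u = v"
proof
  assume "adr A B u = adr A' B' v"
  then have "(A * K + B) * n + u = (A' * K + B') * n + v" by (simp add: adr_def)
  then show "A = A' \<and> B = B' \<and> u = v"
    using mult_add_inject[of "A * K + B" n u "A' * K + B'" v] mult_add_inject[of A K B A' B'] assms
    by auto
qed simp

text \<open>Entries are filled in the order of \<open>A * K + B\<close>: earlier ones are final, the
  current one holds \<open>f\<close>, later ones are still 0. With this order \<open>B = K\<close>
  denotes the start of the next row.\<close>

definition table :: "nat \<Rightarrow> nat \<Rightarrow> (nat \<Rightarrow> real) \<Rightarrow> (nat \<Rightarrow> real) \<Rightarrow> bool" where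
  "table A B f R \<longleftrightarrow> (\<forall>A'<K. \<forall>B'<K. \<forall>u<n. R (adr A' B' u) =
     (if A' * K + B' < A * K + B then G A' B' u else if A' * K + B' = A * K + B then f u else 0))"

lemma table_current: "table A B f R \<Longrightarrow> A < K \<Longrightarrow> B < K \<Longrightarrow> u < n \<Longrightarrow> R (adr A B u) = f u"
  by (simp add: table_def)

text \<open>Clearing a bit of \<open>B\<close> strictly lowers \<open>B\<close> and clearing one of
  \<open>A\<close> does not raise \<open>A\<close>, so the recurrence reads only final
  entries.\<close>

lemma table_earlier:
  assumes "table A B f R" "A < K" "B < K" "u < n" "bit A a" "bit B b"
  shows "R (adr (A - 2 ^ a) (B - 2 ^ b) u) = G (A - 2 ^ a) (B - 2 ^ b) u"
proof -
  have "(A - 2 ^ a) * K \<le> A * K" by (intro mult_le_mono1) simp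
  moreover have "B - 2 ^ b < B"
    using bit_imp_le[OF assms(6)] by (metis diff_less less_le_trans zero_less_numeral zero_less_power)
  ultimately have "(A - 2 ^ a) * K + (B - 2 ^ b) < A * K + B" by linarith
  moreover have "A - 2 ^ a < K" "B - 2 ^ b < K" using assms by auto
  ultimately show ?thesis using assms(1,4) by (simp add: table_def)
qed

lemma table_update:
  assumes "table A B f R" "A < K" "B < K" "v < n"
  shows "table A B (f(v := y)) (R(adr A B v := y))"
  unfolding table_def
proof (intro allI impI)
  fix A' B' u assume A': "A' < K" "B' < K" "u < n"
  have "A' * K + B' = A * K + B \<longleftrightarrow> A' = A \<and> B' = B"
    using mult_add_inject[of A' K B' A B] A' assms by auto
  then show "(R(adr A B v := y)) (adr A' B' u) = (if A' * K + B' < A * K + B then G A' B' u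
      else if A' * K + B' = A * K + B then (f(v := y)) u else 0)"
    using assms A' adr_eq_iff[of B' B u v A' A] by (auto simp: table_def)
qed

lemma table_finish:
  assumes "table A B f R" "B < K" "\<And>u. u < n \<Longrightarrow> f u = G A B u"
  shows "table A (Suc B) (\<lambda>u. 0) R"
  unfolding table_def
proof (intro allI impI)
  fix A' B' u assume A': "A' < K" "B' < K" "u < n"
  have "A' * K + B' = A * K + B \<longleftrightarrow> A' = A \<and> B' = B"
    using mult_add_inject[of A' K B' A B] A' assms by auto
  then show "R (adr A' B' u) = (if A' * K + B' < A * K + Suc B then G A' B' u
      else if A' * K + B' = A * K + Suc B then 0 else 0)"
    using assms A' by (auto simp: table_def less_Suc_eq)
qed

section \<open>The scan over arcs and trips\<close>

definition segment_sum :: "nat \<Rightarrow> nat \<Rightarrow> nat \<Rightarrow> nat \<Rightarrow> nat \<Rightarrow> real" where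
  "segment_sum A B i l v = (\<Sum>j<l. if dst (Ts ! i ! j) = v
     then \<Sum>j'\<le>j. gram_step A B (real i) (src (Ts ! i ! j')) else 0)"

lemma segment_sum_Suc: "segment_sum A B i (Suc l) v = segment_sum A B i l v +
    (if dst (Ts ! i ! l) = v then \<Sum>j'<Suc l. gram_step A B (real i) (src (Ts ! i ! j')) else 0)"
  by (simp add: segment_sum_def lessThan_Suc_atMost[symmetric])

definition partial_sum :: "nat \<Rightarrow> nat \<Rightarrow> nat \<Rightarrow> nat \<Rightarrow> real" where
  "partial_sum A B i v = (if A = 0 \<and> B = 0 \<and> v = s then 1 else 0) +
     (\<Sum>i'<i. segment_sum A B i' (length (Ts ! i')) v)"

definition at_entry :: "nat \<Rightarrow> nat \<Rightarrow> nat \<Rightarrow> state \<Rightarrow> bool" where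
  "at_entry z A B \<sigma> \<longleftrightarrow> env \<sigma> \<and> wreg \<sigma> 0 = z \<and> wreg \<sigma> 11 = A \<and> wreg \<sigma> 12 = B"

abbreviation arc_cost :: nat where
  "arc_cost \<equiv> 20 + (9 + 16 * k) * k"

text \<open>Here \<open>f\<close> is the entry as it stood when the scan of trip \<open>i\<close>
  began, and \<open>off i + 1\<close> skips the length word of the trip.\<close>

definition arc_inv :: "nat \<Rightarrow> nat \<Rightarrow> nat \<Rightarrow> nat \<Rightarrow> (nat \<Rightarrow> real) \<Rightarrow> nat \<Rightarrow> state \<Rightarrow> bool" where
  "arc_inv z A B i f j \<sigma> \<longleftrightarrow> at_entry z A B \<sigma> \<and> wreg \<sigma> 14 = i \<and> wreg \<sigma> 13 = off i + 1 + j \<and>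
    wreg \<sigma> 15 = off i + 1 + length (Ts ! i) \<and> rreg \<sigma> 2 = real i \<and>
    rreg \<sigma> 3 = (\<Sum>j'<j. gram_step A B (real i) (src (Ts ! i ! j'))) \<and>
    table A B (\<lambda>v. f v + segment_sum A B i j v) (rmem \<sigma>)"

lemma arc_step:
  assumes A: "A < K" "B < K" and i: "i < length Ts" "j < length (Ts ! i)" and inv: "arc_inv z A B i f j \<sigma>"
  shows "wp w arc_body arc_cost (arc_inv z A B i f (Suc j)) \<sigma>"
proof -
  define e where "e = Ts ! i ! j"
  have e: "e < ma" "src e < n" "dst e < n" using arc[OF i] by (auto simp: e_def)
  define x where "x = real i"
  note regs = inv[unfolded arc_inv_def at_entry_def env_def]
  have tab: "table A B (\<lambda>v. f v + segment_sum A B i j v) (rmem \<sigma>)" using regs by blast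
  have words: "W (off i + 1 + j) = e" "(e + e) mod 2 ^ w = e + e" "(e + e + 6) mod 2 ^ w = e + e + 6"
    "(e + e + 6 + 1) mod 2 ^ w = e + e + 7" "W (e + e + 6) = src e" "W (e + e + 7) = dst e"
    using trip_words(2)[OF i] arc_words[OF e(1)] arc_bounds[OF e(1)]
    by (simp_all add: e_def mult_2[symmetric])
  define \<rho> where "\<rho> = fold (instr_step w) [Load 16 13, Op Add 16 16 16, Op Add 16 16 9, Load 17 16, Op Add 16 16 8,
    Load 18 16, ROp RSub 4 0 0, ROp RSub 5 8 0, Const 19 1] \<sigma>"
  have s: "wmem \<rho> = W" "rmem \<rho> = rmem \<sigma>" "\<And>r. r \<notin> {16, 17, 18, 19} \<Longrightarrow> wreg \<rho> r = wreg \<sigma> r"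
    "wreg \<rho> 17 = src e" "wreg \<rho> 18 = dst e" "wreg \<rho> 19 = 1"
    "\<And>r. r \<notin> {4, 5} \<Longrightarrow> rreg \<rho> r = rreg \<sigma> r" "rreg \<rho> 4 = 0" "rreg \<rho> 5 = 1"
    unfolding \<rho>_def using regs words w_pos by simp_all
  have loop: "wp w (While (Less 19 6) row_body) (1 + (9 + 16 * k) * k)
    (\<lambda>\<sigma>'. keeps {16, 19, 20, 21, 22} {4, 5, 6, 7} \<rho> \<sigma>' \<and>
      rreg \<sigma>' 4 = rreg \<rho> 4 + gram_step A B x (src e)) \<rho>"
  proof (rule row_loop)
    show "env \<rho>" unfolding env_def using regs by (simp add: s)
    show "rmem \<rho> (adr (A - 2 ^ a) (B - 2 ^ b) (src e)) = G (A - 2 ^ a) (B - 2 ^ b) (src e)"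
      if "bit A a" "bit B b" for a b
      using table_earlier[OF tab A e(2) that] by (simp only: s)
  qed (use regs A e in \<open>simp_all add: s x_def\<close>)
  have post: "arc_inv z A B i f (Suc j) (fold (instr_step w) [ROp RAdd 3 3 4, Op Mul 16 11 6, Op Add 16 16 12,
      Op Mul 16 16 23, Op Add 16 16 18, Op Add 16 16 2, RLoad 7 16, ROp RAdd 7 7 3, RStore 16 7,
      Op Add 13 13 8] \<sigma>')"
    if "keeps {16, 19, 20, 21, 22} {4, 5, 6, 7} \<rho> \<sigma>' \<and> rreg \<sigma>' 4 = rreg \<rho> 4 + gram_step A B x (src e)" for \<sigma>'
  proof -
    have s': "wmem \<sigma>' = W" "rmem \<sigma>' = rmem \<sigma>" "\<And>r. r \<notin> {16, 17, 18, 19, 20, 21, 22} \<Longrightarrow> wreg \<sigma>' r = wreg \<sigma> r"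
      "wreg \<sigma>' 18 = dst e" "\<And>r. r \<notin> {4, 5, 6, 7} \<Longrightarrow> rreg \<sigma>' r = rreg \<sigma> r"
      "rreg \<sigma>' 4 = gram_step A B x (src e)"
      using that s by (simp_all add: keeps_def)
    \<comment> \<open>Arc \<open>j\<close> changes only the value at its head. The bound
      \<open>Suc j\<close> admits boarding and leaving on the same arc.\<close>
    define y where "y = f (dst e) + segment_sum A B i j (dst e) +
      (\<Sum>j'<Suc j. gram_step A B (real i) (src (Ts ! i ! j')))"
    have "rmem \<sigma> ((A * K + B) * n + dst e + ma) = f (dst e) + segment_sum A B i j (dst e)"
      using table_current[OF tab A e(3)] by (simp add: adr_def)
    moreover have "table A B ((\<lambda>v. f v + segment_sum A B i j v)(dst e := y))
        ((rmem \<sigma>)((A * K + B) * n + dst e + ma := y))"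
      using table_update[OF tab A e(3)] by (simp add: adr_def)
    then have "table A B (\<lambda>v. f v + segment_sum A B i (Suc j) v)
        ((rmem \<sigma>)((A * K + B) * n + dst e + ma := y))"
      by (rule back_subst[where P = "\<lambda>f. table A B f _"]) (auto simp: segment_sum_Suc y_def e_def fun_eq_iff)
    ultimately show ?thesis
      using off_bounds[OF i] regs
      by (simp add: arc_inv_def at_entry_def env_def s' adr_less[OF A e(3)[unfolded e_def]] y_def x_def e_def)
  qed
  show ?thesis
    unfolding arc_body_def
    by (rule wp_le, rule wp_Seq, rule wp_block, rule wp_Seq, rule wp_conseq, rule loop[unfolded \<rho>_def],
        rule wp_block, rule post[unfolded \<rho>_def]) simp_all
qed

definition trip_inv :: "nat \<Rightarrow> nat \<Rightarrow> nat \<Rightarrow> nat \<Rightarrow> state \<Rightarrow> bool" where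
  "trip_inv z A B i \<sigma> \<longleftrightarrow> at_entry z A B \<sigma> \<and> wreg \<sigma> 14 = i \<and> wreg \<sigma> 13 = off i \<and>
    table A B (partial_sum A B i) (rmem \<sigma>)"

lemma partial_sum_Suc:
  "partial_sum A B (Suc i) = (\<lambda>v. partial_sum A B i v + segment_sum A B i (length (Ts ! i)) v)"
  by (simp add: partial_sum_def fun_eq_iff add.assoc)

lemma trip_step:
  assumes A: "A < K" "B < K" and i: "i < length Ts" and inv: "trip_inv z A B i \<sigma>"
  shows "wp w trip_body (7 + length (Ts ! i) * (1 + arc_cost)) (trip_inv z A B (Suc i)) \<sigma>"
proof -
  note regs = inv[unfolded trip_inv_def at_entry_def env_def]
  let ?I = "arc_inv z A B i (partial_sum A B i)"
  have bound: "off i + 1 + length (Ts ! i) < 2 ^ w"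
    using off_mono[of "Suc i"] off(2)[of i] i fits(1) by simp
  have init: "?I 0 (fold (instr_step w) [RCast 2 14, Load 15 13, Op Add 13 13 8, Op Add 15 15 13,
      ROp RSub 3 0 0] \<sigma>)"
    using regs bound trip_words(1)[OF i]
    by (simp add: arc_inv_def at_entry_def env_def segment_sum_def add.commute)
  have loop: "wp w (While (Less 13 15) arc_body) (1 + (\<Sum>j<length (Ts ! i). 1 + arc_cost))
      (?I (length (Ts ! i))) (fold (instr_step w) [RCast 2 14, Load 15 13, Op Add 13 13 8,
      Op Add 15 15 13, ROp RSub 3 0 0] \<sigma>)"
  proof (rule wp_While[where I = "?I"])
    fix j \<sigma>' assume "j < length (Ts ! i)" "?I j \<sigma>'"
    then show "holds (Less 13 15) \<sigma>' \<and> wp w arc_body arc_cost (?I (Suc j)) \<sigma>'"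
      using arc_step[OF A i] by (simp add: arc_inv_def)
  qed (use init in \<open>auto simp: arc_inv_def\<close>)
  have post: "trip_inv z A B (Suc i) (fold (instr_step w) [Op Add 14 14 8] \<sigma>')"
    if "?I (length (Ts ! i)) \<sigma>'" for \<sigma>'
    using that i fits(2) off(2)[OF i]
    by (simp add: trip_inv_def arc_inv_def at_entry_def env_def partial_sum_Suc)
  show ?thesis
    unfolding trip_body_def
    by (rule wp_le, rule wp_Seq, rule wp_block, rule wp_Seq, rule wp_conseq, rule loop,
        rule wp_block, rule post) simp_all
qed

definition entry_cost :: nat where
  "entry_cost = 4 + (\<Sum>i<length Ts. 8 + length (Ts ! i) * (1 + arc_cost))"

definition entry_inv :: "nat \<Rightarrow> nat \<Rightarrow> nat \<Rightarrow> state \<Rightarrow> bool" where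
  "entry_inv z A B \<sigma> \<longleftrightarrow> at_entry z A B \<sigma> \<and> table A B (partial_sum A B 0) (rmem \<sigma>)"

end

text \<open>The recurrence is a separate assumption because it is phrased with
  \<open>partial_sum\<close>: the value after scanning all trips is the final entry.\<close>

locale ride_gram_table = ride_table +
  assumes G_rec: "A < K \<Longrightarrow> B < K \<Longrightarrow> v < n \<Longrightarrow> G A B v = partial_sum A B (length Ts) v"
begin

section \<open>The loops over the two masks\<close>

lemma entry_step:
  assumes A: "A < K" "B < K" and inv: "entry_inv z A B \<sigma>"
  shows "wp w entry_body entry_cost (entry_inv z A (Suc B)) \<sigma>"
proof -
  note regs = inv[unfolded entry_inv_def at_entry_def env_def]
  let ?s = "fold (instr_step w) [Op Add 13 10 7, Const 14 0] \<sigma>"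
  have "2 * ma + 6 < 2 ^ w"
    using off_mono[of 0] off(1) fits(1) by simp
  then have init: "trip_inv z A B 0 ?s"
    using regs by (simp add: trip_inv_def at_entry_def env_def off(1))
  have loop: "wp w (While (Less 14 3) trip_body)
      (1 + (\<Sum>i<length Ts. 1 + (7 + length (Ts ! i) * (1 + arc_cost)))) (trip_inv z A B (length Ts)) ?s"
  proof (rule wp_While[where I = "trip_inv z A B"])
    fix i \<sigma>' assume i: "i < length Ts" "trip_inv z A B i \<sigma>'"
    then have "holds (Less 14 3) \<sigma>'"
      by (simp add: trip_inv_def at_entry_def env_def)
    with trip_step[OF A i] show "holds (Less 14 3) \<sigma>' \<and>
        wp w trip_body (7 + length (Ts ! i) * (1 + arc_cost)) (trip_inv z A B (Suc i)) \<sigma>'"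
      by blast
  qed (use init in \<open>auto simp: trip_inv_def at_entry_def env_def\<close>)
  have post: "entry_inv z A (Suc B) (fold (instr_step w) [Op Add 12 12 8] \<sigma>')"
    if "trip_inv z A B (length Ts) \<sigma>'" for \<sigma>'
  proof -
    have "table A (Suc B) (\<lambda>u. 0) (rmem \<sigma>')"
      using that A G_rec by (intro table_finish[of A B "partial_sum A B (length Ts)"])
        (auto simp: trip_inv_def)
    \<comment> \<open>The initial 1 belongs only to the pair of empty masks, so the next entry
      starts at zero.\<close>
    moreover have "partial_sum A (Suc B) 0 = (\<lambda>u. 0)"
      by (simp add: partial_sum_def fun_eq_iff)
    ultimately have "table A (Suc B) (partial_sum A (Suc B) 0) (rmem \<sigma>')"
      by simp
    then show ?thesis
      using that K_less A by (simp add: trip_inv_def entry_inv_def at_entry_def env_def)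
  qed
  show ?thesis
    unfolding entry_body_def
    by (rule wp_le, rule wp_Seq, rule wp_block, rule wp_Seq, rule wp_conseq, rule loop,
        rule wp_block, rule post) (simp_all add: entry_cost_def)
qed

definition mask_inv :: "nat \<Rightarrow> state \<Rightarrow> bool" where
  "mask_inv A \<sigma> \<longleftrightarrow> env \<sigma> \<and> wreg \<sigma> 0 = (if \<exists>A'<A. 0 < G A' A' t then 1 else 0) \<and> wreg \<sigma> 11 = A \<and>
    table A 0 (partial_sum A 0 0) (rmem \<sigma>)"

abbreviation mask_cost :: nat where
  "mask_cost \<equiv> 11 + K * (1 + entry_cost)"

lemma mask_step:
  assumes A: "A < K" and inv: "mask_inv A \<sigma>"
  shows "wp w mask_body mask_cost (mask_inv (Suc A)) \<sigma>"
proof -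
  define z :: nat where "z = (if \<exists>A'<A. 0 < G A' A' t then 1 else 0)"
  note regs = inv[unfolded mask_inv_def env_def z_def[symmetric]]
  have init: "entry_inv z A 0 (fold (instr_step w) [Const 12 0] \<sigma>)"
    using regs by (simp add: entry_inv_def at_entry_def env_def)
  have loop: "wp w (While (Less 12 6) entry_body) (1 + (\<Sum>B<K. 1 + entry_cost)) (entry_inv z A K)
      (fold (instr_step w) [Const 12 0] \<sigma>)"
  proof (rule wp_While[where I = "entry_inv z A"])
    fix B \<sigma>' assume B: "B < K" "entry_inv z A B \<sigma>'"
    then have "holds (Less 12 6) \<sigma>'"
      by (simp add: entry_inv_def at_entry_def env_def)
    with entry_step[OF A B]
    show "holds (Less 12 6) \<sigma>' \<and> wp w entry_body entry_cost (entry_inv z A (Suc B)) \<sigma>'"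
      by blast
  qed (use init in \<open>auto simp: entry_inv_def at_entry_def env_def\<close>)
  have post: "wp w (Seq (block (Op Mul 16 11 6) [Op Add 16 16 11, Op Mul 16 16 23, Op Add 16 16 5,
      Op Add 16 16 2, RLoad 7 16]) (Seq (Cond (RLess 0 7) (block (Const 0 1) []) (block (Const 16 0) []))
      (block (Op Add 11 11 8) []))) 9 (mask_inv (Suc A)) \<sigma>'"
    if \<sigma>': "entry_inv z A K \<sigma>'" for \<sigma>'
  proof -
    note regs' = \<sigma>'[unfolded entry_inv_def at_entry_def env_def]
    \<comment> \<open>The end of row \<open>A\<close> is the start of row \<open>Suc A\<close> in
      the filling order; in particular the diagonal entry tested next is final.\<close>
    have tab: "table (Suc A) 0 (partial_sum (Suc A) 0 0) (rmem \<sigma>')"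
    proof -
      have "table A K (partial_sum A K 0) (rmem \<sigma>')" using regs' by blast
      moreover have "partial_sum A K 0 = (\<lambda>u. 0)" "partial_sum (Suc A) 0 0 = (\<lambda>u. 0)"
        using A by (auto simp: partial_sum_def fun_eq_iff)
      moreover have "Suc A * K + 0 = A * K + K" by simp
      ultimately show ?thesis unfolding table_def by metis
    qed
    have "A * K + A < A * K + K" using A by simp
    then have entry: "rmem \<sigma>' ((A * K + A) * n + t + ma) = G A A t"
      using tab A node(2) by (simp add: table_def adr_def add.commute)
    have word: "Suc A < 2 ^ w" using A K_less by simp
    have ex: "(\<exists>A'<Suc A. 0 < G A' A' t) \<longleftrightarrow> (\<exists>A'<A. 0 < G A' A' t) \<or> 0 < G A A t"
      by (auto simp: less_Suc_eq)
    show ?thesis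
      apply (rule wp_le, rule wp_Seq, rule wp_block, rule wp_Seq, rule wp_Cond, rule wp_block, rule wp_block)
      apply (rule_tac [2] wp_block, rule_tac [2] wp_block)
      using regs' tab word
      apply (simp_all add: mask_inv_def env_def entry adr_less[OF A A node(2)] w_pos ex z_def)
      done
  qed
  show ?thesis
    unfolding mask_body_def
    by (rule wp_le, rule wp_Seq, rule wp_block, rule wp_Seq, rule wp_conseq, rule loop, rule post) simp_all
qed

lemma ride_program_run:
  assumes "wmem \<sigma> = W" "\<And>r. wreg \<sigma> r = 0" "\<And>r. rreg \<sigma> r = 0" "\<And>a. ma \<le> a \<Longrightarrow> rmem \<sigma> a = 0"
  shows "wp w ride_program (19 + K * (1 + mask_cost))
    (\<lambda>\<sigma>'. wreg \<sigma>' 0 = (if \<exists>A<K. 0 < G A A t then 1 else 0)) \<sigma>"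
proof -
  define \<rho> where "\<rho> = fold (instr_step w) [Const 8 1, Load 23 7, Load 2 8, Const 16 2, Load 3 16, Const 16 3,
      Load 4 16, Const 16 4, Load 5 16, Const 16 5, Load 6 16, Op Shl 6 8 6, Const 9 6, Op Add 10 2 2,
      Op Add 10 10 9, RCast 8 8, Op Add 16 4 2, RStore 16 8] \<sigma>"
  have "ma + ma + 6 < 2 ^ w"
    using off_mono[of 0] off(1) fits(1) by simp
  moreover have "s + ma < 2 ^ w"
    using adr_less(5)[of 0 0 s] node K by simp
  \<comment> \<open>The real memory behind the weights is initially zero, so one store establishes
    the table invariant.\<close>
  moreover have "table 0 0 (partial_sum 0 0 0) ((rmem \<sigma>)(s + ma := 1))"
    unfolding table_def
  proof (intro allI impI)
    fix A B u assume "A < K" "B < K" "u < n"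
    then show "((rmem \<sigma>)(s + ma := 1)) (adr A B u) = (if A * K + B < 0 * K + 0 then G A B u
      else if A * K + B = 0 * K + 0 then partial_sum 0 0 0 u else 0)"
      using adr_eq_iff[of B 0 u s A 0] node(1) assms(4)[of "adr A B u"]
      by (auto simp: partial_sum_def adr_def)
  qed
  moreover have "x mod 2 ^ w = x" if "x \<le> 8" for x :: nat
    using that fits(4) by simp
  ultimately have init: "mask_inv 0 \<rho>"
    using assms header K_less w_pos
    by (simp add: mask_inv_def env_def K[symmetric] push_bit_eq_mult \<rho>_def)
  have loop: "wp w (While (Less 11 6) mask_body) (1 + (\<Sum>A<K. 1 + mask_cost)) (mask_inv K) \<rho>"
  proof (rule wp_While[where I = "mask_inv"])
    fix A \<sigma>' assume A: "A < K" "mask_inv A \<sigma>'"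
    then have "holds (Less 11 6) \<sigma>'"
      by (simp add: mask_inv_def env_def)
    with mask_step[OF A] show "holds (Less 11 6) \<sigma>' \<and> wp w mask_body mask_cost (mask_inv (Suc A)) \<sigma>'"
      by blast
  qed (use init in \<open>auto simp: mask_inv_def env_def\<close>)
  have "wp w ride_program (19 + K * (1 + mask_cost)) (mask_inv K) \<sigma>"
    unfolding ride_program_def
    by (rule wp_le, rule wp_Seq, rule wp_block, rule loop[unfolded \<rho>_def]) simp
  then show ?thesis
    by (rule wp_conseq) (simp add: mask_inv_def)
qed

end

section \<open>Masks, input encoding and running time\<close>

definition bits :: "nat \<Rightarrow> nat set" where
  "bits A = {a. bit A a}"

lemma bits_iff: "a \<in> bits A \<longleftrightarrow> bit A a"
  by (simp add: bits_def)

lemma bits_less: "A < 2 ^ k \<Longrightarrow> bits A \<subseteq> {..<k}"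
proof
  fix a assume "A < 2 ^ k" "a \<in> bits A"
  then have "2 ^ a < (2 :: nat) ^ k"
    using bit_imp_le[of A a] le_less_trans[of "2 ^ a" A] by (simp only: bits_def mem_Collect_eq)
  then show "a \<in> {..<k}" by simp
qed

text \<open>As the bit is present, subtraction causes no borrow and agrees with
  \<open>unset_bit\<close>.\<close>

lemma bits_remove:
  assumes "bit A a"
  shows "bits (A - 2 ^ a) = bits A - {a}"
proof -
  have "int (unset_bit a A) = int (A - 2 ^ a)"
    using assms bit_imp_le[OF assms]
    by (simp add: of_nat_unset_bit_eq unset_bit_eq bit_of_nat_iff_bit of_nat_diff)
  then have "A - 2 ^ a = unset_bit a A" by simp
  then show ?thesis by (auto simp: bits_def bit_unset_bit_iff)
qed

lemma bits_zero_iff: "bits A = {} \<longleftrightarrow> A = 0"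
  by (auto simp: bits_def bit_eq_iff)

text \<open>A mask is built bit by bit and then truncated by \<open>take_bit\<close>, which puts it
  below \<open>2 ^ k\<close> without changing its set of bits.\<close>

lemma bits_surj:
  assumes "S \<subseteq> {..<k}"
  shows "\<exists>A<2 ^ k. bits A = S"
proof -
  have "finite S" using assms finite_subset by blast
  then have "\<exists>A. bits A = S"
  proof (induction S rule: finite_induct)
    case empty
    then show ?case by (intro exI[of _ 0]) (simp add: bits_def)
  next
    case (insert a S)
    then obtain A where "bits A = S" by blast
    then show ?case by (intro exI[of _ "set_bit a A"]) (auto simp: bits_def bit_set_bit_iff)
  qed
  then obtain A where "bits A = S" by blast
  then have "bits (take_bit k A) = S"
    using assms by (auto simp: bits_def bit_take_bit_iff)
  then show ?thesis using take_bit_nat_less_exp by blast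
qed

lemma bit_sign_eq: "bit_sign A a = altsign (bits A) a"
  by (simp add: bit_sign_def bits_def conj_commute)

lemma sum_bits: "A < 2 ^ k \<Longrightarrow> sum f (bits A) = (\<Sum>a<k. if bit A a then f a else 0)"
proof -
  assume "A < 2 ^ k"
  then have "bits A = {a \<in> {..<k}. bit A a}" using bits_less[of A k] by (auto simp: bits_def)
  then show ?thesis by (simp only: sum.inter_filter[OF finite_lessThan])
qed

section \<open>Layout of the input\<close>

lemma nth_concat_pairs:
  "e < m \<Longrightarrow> concat (map (\<lambda>e. [f e, g e]) [0..<m]) ! (2 * e) = f e \<and>
    concat (map (\<lambda>e. [f e, g e]) [0..<m]) ! (2 * e + 1) = g e"
  "length (concat (map (\<lambda>e. [f e, g e]) [0..<m])) = 2 * m"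
proof -
  show len: "length (concat (map (\<lambda>e. [f e, g e]) [0..<m])) = 2 * m" for m
    by (induction m) auto
  show "e < m \<Longrightarrow> concat (map (\<lambda>e. [f e, g e]) [0..<m]) ! (2 * e) = f e \<and>
    concat (map (\<lambda>e. [f e, g e]) [0..<m]) ! (2 * e + 1) = g e"
  proof (induction m)
    case (Suc m)
    then show ?case by (cases "e = m") (auto simp: nth_append len)
  qed simp
qed

lemma nth_concat_prefixed:
  "i < length Ts \<Longrightarrow> concat (map (\<lambda>T. length T # T) Ts) ! (\<Sum>l<i. 1 + length (Ts ! l)) = length (Ts ! i)"
  "i < length Ts \<Longrightarrow> j < length (Ts ! i) \<Longrightarrow>
    concat (map (\<lambda>T. length T # T) Ts) ! ((\<Sum>l<i. 1 + length (Ts ! l)) + 1 + j) = Ts ! i ! j"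
  "length (concat (map (\<lambda>T. length T # T) Ts)) = (\<Sum>l<length Ts. 1 + length (Ts ! l))"
proof -
  show "i < length Ts \<Longrightarrow> concat (map (\<lambda>T. length T # T) Ts) ! (\<Sum>l<i. 1 + length (Ts ! l)) = length (Ts ! i)"
  proof (induction Ts arbitrary: i)
    case (Cons T Ts)
    then show ?case by (cases i) (auto simp: sum.lessThan_Suc_shift nth_append simp del: sum.lessThan_Suc)
  qed simp
  show "i < length Ts \<Longrightarrow> j < length (Ts ! i) \<Longrightarrow>
    concat (map (\<lambda>T. length T # T) Ts) ! ((\<Sum>l<i. 1 + length (Ts ! l)) + 1 + j) = Ts ! i ! j"
  proof (induction Ts arbitrary: i)
    case (Cons T Ts)
    then show ?case by (cases i) (auto simp: sum.lessThan_Suc_shift nth_append simp del: sum.lessThan_Suc)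
  qed simp
  show "length (concat (map (\<lambda>T. length T # T) Ts)) = (\<Sum>l<length Ts. 1 + length (Ts ! l))"
    by (induction Ts) (auto simp: sum.lessThan_Suc_shift simp del: sum.lessThan_Suc)
qed

section \<open>Instance size and word length\<close>

lemma total_trip_length_eq:
  "total_trip_length Ts = (\<Sum>i<length Ts. length (Ts ! i))" "total_trip_length Ts = length (concat Ts)"
  by (simp_all add: total_trip_length_def sum_list_sum_nth atLeast0LessThan length_concat)

context trip_network
begin

lemma card_arcs_le: "card (arcs D) \<le> total_trip_length Ts"
proof -
  have "arcs D \<subseteq> set (concat Ts)" using arc_in_trip by auto
  then have "card (arcs D) \<le> card (set (concat Ts))" by (intro card_mono) auto
  also have "\<dots> \<le> length (concat Ts)" by (rule card_length)
  finally show ?thesis by (simp only: total_trip_length_eq(2))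
qed

lemma card_verts_le: "card (verts D) \<le> 2 * total_trip_length Ts"
proof -
  have "verts D \<subseteq> set (map (tail D) (concat Ts) @ map (head D) (concat Ts))"
    using node_in_trip by fastforce
  then have "card (verts D) \<le> card (set (map (tail D) (concat Ts) @ map (head D) (concat Ts)))"
    by (intro card_mono) auto
  also have "\<dots> \<le> length (map (tail D) (concat Ts) @ map (head D) (concat Ts))" by (rule card_length)
  finally show ?thesis by (simp add: total_trip_length_eq(2))
qed

lemma length_trips_le: "length Ts \<le> total_trip_length Ts"
proof -
  have "1 \<le> length (Ts ! i)" if "i < length Ts" for i
    using trip_nonempty[of "Ts ! i"] that by (simp add: Suc_le_eq)
  then have "(\<Sum>i<length Ts. 1) \<le> (\<Sum>i<length Ts. length (Ts ! i))" by (intro sum_mono) auto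
  then show ?thesis by (simp add: total_trip_length_eq(1))
qed

end

text \<open>The hypothesis on the word length is exponentiated, which gives a polynomial bound for
  addresses in \<open>2 ^ k\<close> and the total trip length.\<close>

lemma word_capacity:
  assumes "real 4 * (real k + log 2 (real m + 1)) \<le> real w"
  shows "2 ^ (4 * k) * (m + 1) ^ 4 \<le> (2 :: nat) ^ w"
proof -
  have "2 powr (real 4 * (real k + log 2 (real m + 1))) \<le> 2 powr real w"
    using assms by simp
  moreover have "2 powr (real 4 * (real k + log 2 (real m + 1))) =
      2 powr (real (4 * k)) * (2 powr (log 2 (real m + 1))) powr real 4"
    by (simp only: powr_powr flip: powr_add) (simp add: algebra_simps)
  moreover have "2 powr (log 2 (real m + 1)) = real m + 1" by simp
  moreover have "2 powr real (4 * k) = (2 :: real) ^ (4 * k)" "2 powr real w = (2 :: real) ^ w"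
    "(real m + 1) powr real 4 = (real m + 1) ^ 4"
    by (rule powr_realpow, simp)+
  ultimately have "2 ^ (4 * k) * (real m + 1) ^ 4 \<le> (2 :: real) ^ w"
    by (simp only:)
  then have "real (2 ^ (4 * k) * (m + 1) ^ 4) \<le> real (2 ^ w)"
    by (simp add: add.commute)
  then show ?thesis by (simp only: of_nat_le_iff)
qed

section \<open>The recurrence in terms of masks\<close>

context trip_network
begin

definition mask_gram :: "'v \<Rightarrow> nat \<Rightarrow> nat \<Rightarrow> 'v \<Rightarrow> real" where
  "mask_gram s A B v = ride_gram D Ts s (bits A) (bits B) v"

lemma o2o_rtt_iff_mask_gram:
  assumes "s \<in> verts D"
  shows "o2o_rtt D wt Ts s t k \<longleftrightarrow> (\<exists>A<2 ^ k. 0 < mask_gram s A A t)"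
  unfolding o2o_rtt_iff_ride_gram[OF assms] mask_gram_def
  using bits_surj bits_less by metis

text \<open>Sums over exponent sets become sums over bit positions, with the factor of
  \<open>a\<close> in front of the sum over \<open>b\<close>, exactly as the nested loops evaluate
  them.\<close>

lemma mask_gram_rec:
  assumes "A < 2 ^ k" "B < 2 ^ k"
  shows "mask_gram s A B v = (if A = 0 \<and> B = 0 \<and> v = s then 1 else 0) +
    (\<Sum>i<length Ts. \<Sum>j<length (Ts ! i). if head D (Ts ! i ! j) = v
       then \<Sum>j'\<le>j. \<Sum>a<k. if bit A a then bit_sign A a * real i ^ a *
         (\<Sum>b<k. if bit B b then bit_sign B b * real i ^ b *
           mask_gram s (A - 2 ^ a) (B - 2 ^ b) (tail D (Ts ! i ! j')) else 0) else 0
       else 0)"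
proof -
  have fin: "finite (bits A)" "finite (bits B)"
    using assms bits_less finite_subset by blast+
  have step: "(\<Sum>a\<in>bits A. \<Sum>b\<in>bits B. altsign (bits A) a * x ^ a * (altsign (bits B) b * x ^ b) *
      ride_gram D Ts s (bits A - {a}) (bits B - {b}) u) =
    (\<Sum>a<k. if bit A a then bit_sign A a * x ^ a *
         (\<Sum>b<k. if bit B b then bit_sign B b * x ^ b * mask_gram s (A - 2 ^ a) (B - 2 ^ b) u else 0) else 0)"
    for x u
  proof -
    have "(\<Sum>a\<in>bits A. \<Sum>b\<in>bits B. altsign (bits A) a * x ^ a * (altsign (bits B) b * x ^ b) *
        ride_gram D Ts s (bits A - {a}) (bits B - {b}) u) =
      (\<Sum>a\<in>bits A. bit_sign A a * x ^ a *
        (\<Sum>b\<in>bits B. bit_sign B b * x ^ b * mask_gram s (A - 2 ^ a) (B - 2 ^ b) u))"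
      unfolding sum_distrib_left bit_sign_eq
      by (intro sum.cong refl) (simp add: mask_gram_def bits_remove bits_iff)
    then show ?thesis by (simp only: sum_bits[OF assms(1)] sum_bits[OF assms(2)])
  qed
  show ?thesis
    unfolding mask_gram_def[of s A B v] ride_gram_rec[OF fin] step bits_zero_iff ..
qed

end

section \<open>Correctness, word length and running time of the program\<close>

theorem theorem4:
  shows "\<exists>(p :: program) (a :: nat) (b :: nat) (c :: nat).
    \<forall>(D :: (nat, nat) pre_digraph) (wt :: nat \<Rightarrow> real) (Ts :: nat list list)
      (s :: nat) (t :: nat) (k :: nat) (w :: nat).
      trip_network D wt Ts \<longrightarrow> numbered D \<longrightarrow> s \<in> verts D \<longrightarrow> t \<in> verts D \<longrightarrow>
      real c * (real k + log 2 (real (total_trip_length Ts) + 1)) \<le> real w \<longrightarrow>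
      decides_within w p (input_words D Ts s t k) (input_reals D wt)
        (o2o_rtt D wt Ts s t k)
        (real a * 2 ^ (b * k) * real (total_trip_length Ts) * max 1 (log 2 (real (length Ts))))"
\<comment> \<open>The exponent \<open>4 * k\<close> stems from \<open>2 ^ k\<close> choices for each
  of two masks and at most \<open>k * k\<close> pairs of exponents per arc, with \<open>k\<close>
  bounded by \<open>2 ^ k\<close>.\<close>
proof (rule exI[of _ ride_program], rule exI[of _ 90], rule exI[of _ 4], rule exI[of _ 4], intro allI impI)
  fix D :: "(nat, nat) pre_digraph" and wt Ts s t k w
  assume net: "trip_network D wt Ts" and num: "numbered D" and s: "s \<in> verts D" and t: "t \<in> verts D"
    and w: "real 4 * (real k + log 2 (real (total_trip_length Ts) + 1)) \<le> real w"
  interpret trip_network D wt Ts by (rule net)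
  define m where "m = total_trip_length Ts"
  define n where "n = card (verts D)"
  define ma where "ma = card (arcs D)"
  define K :: nat where "K = 2 ^ k"
  define off where "off i = 2 * ma + 6 + (\<Sum>l<i. 1 + length (Ts ! l))" for i
  define ws where "ws = input_words D Ts s t k"
  define \<sigma> where "\<sigma> = initial_state w ws (input_reals D wt)"
  have verts: "v \<in> verts D \<longleftrightarrow> v < n" for v
    using num unfolding numbered_def n_def by blast
  have arcs: "e \<in> arcs D \<longleftrightarrow> e < ma" for e
    using num unfolding numbered_def ma_def by blast
  have le: "n \<le> 2 * m" "ma \<le> m" "length Ts \<le> m" "0 < m"
    using card_verts_le card_arcs_le length_trips_le s verts[of s] by (auto simp: m_def n_def ma_def)
  have K: "0 < K" "k < K" by (simp_all add: K_def)
  have cap: "K ^ 4 * (m + 1) ^ 4 \<le> 2 ^ w"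
    using word_capacity[OF w] by (simp add: K_def m_def power_mult mult.commute)
  \<comment> \<open>Used for \<open>M = m + 1\<close>: it turns the fourth power in
    \<open>cap\<close> into slack for the linear bounds on the input length and the table
    size.\<close>
  have pow4: "8 * M \<le> M ^ 4" if "2 \<le> M" for M :: nat
  proof -
    have "2 ^ 3 * M \<le> M ^ 3 * M" using that by (intro mult_le_mono1 power_mono) auto
    moreover have "M ^ 3 * M = M ^ 4" by (simp add: numeral_eq_Suc mult.assoc)
    ultimately show ?thesis by simp
  qed
  have M: "8 * (m + 1) \<le> (m + 1) ^ 4" by (rule pow4) (use le in simp)
  have big: "K * K * (8 * (m + 1)) \<le> 2 ^ w"
  proof -
    have "K * K \<le> K ^ 4" using K power_increasing[of 2 4 K] by (simp add: power2_eq_square)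
    then show ?thesis using mult_le_mono[OF _ M] cap le_trans by blast
  qed
  have "1 * (8 * (m + 1)) \<le> K * K * (8 * (m + 1))" using K by (intro mult_le_mono1) simp
  from order_trans[OF this big] have big1: "8 * (m + 1) \<le> 2 ^ w" by (simp only: mult_1)
  have "K * 1 \<le> K * (K * (8 * (m + 1)))" using K by (intro mult_le_mono2) simp
  then have "K \<le> K * K * (8 * (m + 1))" by (simp only: mult.assoc mult_1_right)
  from order_trans[OF this big] have K_le: "K \<le> 2 ^ w" .
  have off_length: "off (length Ts) = 2 * ma + 6 + length Ts + m"
    by (simp add: off_def m_def total_trip_length_eq(1) sum_Suc)
  have words: "wmem \<sigma> a = ws ! a" if "a < length ws" "ws ! a < 2 ^ w" for a
    using that by (simp add: \<sigma>_def initial_state_def)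
  define P Q where "P = concat (map (\<lambda>e. [tail D e, head D e]) [0..<ma])"
    and "Q = concat (map (\<lambda>T. length T # T) Ts)"
  have ws: "ws = [n, ma, length Ts, s, t, k] @ P @ Q"
    by (simp add: ws_def input_words_def n_def ma_def P_def Q_def)
  have P: "length P = 2 * ma" "\<And>e. e < ma \<Longrightarrow> P ! (2 * e) = tail D e \<and> P ! (2 * e + 1) = head D e"
    unfolding P_def by (rule nth_concat_pairs(2)) (rule nth_concat_pairs(1))
  have len: "length ws = off (length Ts)"
    by (simp add: ws P(1) off_def Q_def nth_concat_prefixed(3) del: length_concat)
  interpret ride_table "tail D" "head D" Ts n ma s t k w K "wmem \<sigma>" off "mask_gram s"
  proof
    show "K = 2 ^ k" by (simp add: K_def)
    show "s < n" "t < n" using s t verts by auto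
    show "Ts ! i ! j < ma \<and> tail D (Ts ! i ! j) < n \<and> head D (Ts ! i ! j) < n"
      if "i < length Ts" "j < length (Ts ! i)" for i j
      using trip_arc[of "Ts ! i" j] that by (auto simp: arcs[symmetric] verts[symmetric])
    show "wmem \<sigma> 0 = n" "wmem \<sigma> (Suc 0) = ma" "wmem \<sigma> 2 = length Ts" "wmem \<sigma> 3 = s" "wmem \<sigma> 4 = t"
      "wmem \<sigma> 5 = k"
      using words[of 0] words[of "Suc 0"] words[of 2] words[of 3] words[of 4] words[of 5] big1 K_le K le s t
        verts[of s] verts[of t]
      by (simp_all add: ws)
    show "wmem \<sigma> (2 * e + 6) = tail D e \<and> wmem \<sigma> (2 * e + 7) = head D e" if "e < ma" for e
    proof -
      have "tail D e < n" "head D e < n" using that by (auto simp: arcs[symmetric] verts[symmetric])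
      moreover have "ws ! (2 * e + 6) = tail D e" "ws ! (2 * e + 7) = head D e"
        using that P by (simp_all add: ws nth_append)
      moreover have "2 * e + 7 < length ws" using that by (simp add: len off_length)
      ultimately show ?thesis using words[of "2 * e + 6"] words[of "2 * e + 7"] big1 le by simp
    qed
    show "off 0 = 2 * ma + 6" "off (Suc i) = off i + 1 + length (Ts ! i)" for i
      by (simp_all add: off_def)
    have off_nth: "ws ! (off i + j) = Q ! ((\<Sum>l<i. 1 + length (Ts ! l)) + j)" for i j
      by (simp add: ws nth_append P(1) off_def)
    have off_le: "off i + 1 + length (Ts ! i) \<le> length ws" if "i < length Ts" for i
    proof -
      have "(\<Sum>l<Suc i. 1 + length (Ts ! l)) \<le> (\<Sum>l<length Ts. 1 + length (Ts ! l))"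
        using that by (intro sum_mono2) auto
      then show ?thesis by (simp add: len off_def)
    qed
    show "wmem \<sigma> (off i) = length (Ts ! i)" if "i < length Ts" for i
      using words[of "off i"] off_nth[of i 0] nth_concat_prefixed(1)[OF that] off_le[OF that] big1 le
      by (simp add: Q_def len off_length)
    show "wmem \<sigma> (off i + 1 + j) = Ts ! i ! j" if "i < length Ts" "j < length (Ts ! i)" for i j
    proof -
      have "Ts ! i ! j < ma" using trip_arc[of "Ts ! i" j] that by (simp add: arcs)
      then show ?thesis
        using words[of "off i + 1 + j"] off_nth[of i "1 + j"] nth_concat_prefixed(2)[OF that] off_le[OF that(1)]
          that big1 le
        by (simp add: Q_def add.assoc)
    qed
    show "off (length Ts) < 2 ^ w" "length Ts < 2 ^ w" "8 < (2 :: nat) ^ w"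
      using big1 le by (simp_all add: off_length)
    have "K * K * n + ma \<le> K * K * (2 * m) + K * K * m"
      using K le by (intro add_mono mult_le_mono2 order_trans[OF le(2)]) auto
    also have "\<dots> < K * K * (8 * (m + 1))" using K by (simp add: algebra_simps)
    finally show "K * K * n + ma < 2 ^ w" using big by linarith
  qed
  interpret ride_gram_table "tail D" "head D" Ts n ma s t k w K "wmem \<sigma>" off "mask_gram s"
  proof
    show "mask_gram s A B v = partial_sum A B (length Ts) v" if "A < K" "B < K" for A B v
      unfolding partial_sum_def segment_sum_def gram_step_def gram_row_def
      by (rule mask_gram_rec) (use that in \<open>simp_all add: K_def\<close>)
  qed
  have "wp w ride_program (19 + K * (1 + mask_cost))
      (\<lambda>\<sigma>'. wreg \<sigma>' 0 = (if \<exists>A<K. 0 < mask_gram s A A t then 1 else 0)) \<sigma>"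
    by (rule ride_program_run) (auto simp: \<sigma>_def initial_state_def input_reals_def ma_def)
  then obtain time \<sigma>' where run: "exec w ride_program \<sigma> time \<sigma>'" "time \<le> 19 + K * (1 + mask_cost)"
    "wreg \<sigma>' 0 = (if o2o_rtt D wt Ts s t k then 1 else 0)"
    unfolding wp_def o2o_rtt_iff_mask_gram[OF s] K_def by blast
  have entry: "entry_cost \<le> 58 * (K ^ 2 * m)"
  proof -
    have "entry_cost = 4 + 8 * length Ts + m * (1 + arc_cost)"
      by (simp add: entry_cost_def m_def total_trip_length_eq(1) sum.distrib sum_distrib_right)
    also have "\<dots> \<le> 4 * m + 8 * m + m * (1 + arc_cost)" using le by simp
    also have "\<dots> = m * (33 + (9 + 16 * k) * k)" by (simp add: algebra_simps)
    \<comment> \<open>Since \<open>k < K\<close>, every factor \<open>k\<close> is replaced by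
      \<open>K\<close>, giving 33 + 9 + 16 = 58.\<close>
    also have "\<dots> \<le> m * (33 * K ^ 2 + (9 * K + 16 * K) * K)"
      using K by (intro mult_le_mono2 add_mono mult_le_mono) auto
    also have "\<dots> = 58 * (K ^ 2 * m)" by (simp add: power2_eq_square)
    finally show ?thesis .
  qed
  have pow: "K ^ 3 = K * K ^ 2" "K ^ 4 = K * K ^ 3"
    by (simp_all flip: power_Suc)
  have one: "1 \<le> K ^ j * m" for j using K le by simp
  \<comment> \<open>Additive constants are absorbed level by level: 58 + 1 = 59, then 59 + 12 = 71
    per mask, and 71 + 19 = 90 overall.\<close>
  have "1 + entry_cost \<le> 59 * (K ^ 2 * m)" using entry one[of 2] by linarith
  then have "K * (1 + entry_cost) \<le> K * (59 * (K ^ 2 * m))" by (rule mult_le_mono2)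
  also have "\<dots> = 59 * (K ^ 3 * m)" by (simp only: pow(1) mult_ac)
  finally have "1 + mask_cost \<le> 71 * (K ^ 3 * m)" using one[of 3] by linarith
  then have "K * (1 + mask_cost) \<le> K * (71 * (K ^ 3 * m))" by (rule mult_le_mono2)
  also have "\<dots> = 71 * (K ^ 4 * m)" by (simp only: pow(2) mult_ac)
  finally have "time \<le> 90 * (K ^ 4 * m)" using one[of 4] run(2) by linarith
  then have "real time \<le> real (90 * (K ^ 4 * m))" by (simp only: of_nat_le_iff)
  also have "\<dots> = real 90 * 2 ^ (4 * k) * real m"
    by (simp add: K_def power_mult mult.commute)
  also have "\<dots> \<le> real 90 * 2 ^ (4 * k) * real m * max 1 (log 2 (real (length Ts)))"
    using mult_left_mono[of 1 "max 1 (log 2 (real (length Ts)))" "real 90 * 2 ^ (4 * k) * real m"] by simp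
  finally show "decides_within w ride_program (input_words D Ts s t k) (input_reals D wt)
      (o2o_rtt D wt Ts s t k)
      (real 90 * 2 ^ (4 * k) * real (total_trip_length Ts) * max 1 (log 2 (real (length Ts))))"
    unfolding decides_within_def using run(1,3) unfolding \<sigma>_def ws_def m_def by blast
qed

end
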